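(* Let $F:[0,\infty)\to\mathcal{L}(\mathfrak{H})$ be a measurable family of non-negative self-adjoint contractions on a Hilbert space $\mathfrak{H}$ such that $F(0)=\mathds{1}$. For $\tau>0$ put $S(\tau):=(\mathds{1}-F(\tau))/\tau$, and let $H\ge0$ be a self-adjoint operator in $\mathfrak{H}$ such that $\operatorname{s-lim}_{\tau\to+0}(\mathds{1}+S(\tau))^{-1}=(\mathds{1}+H)^{-1}$. If for some $\rho\in(0,1]$ there is a constant $M_\rho>0$ such that $$\|(\mathds{1}+tS(\tau))^{-1}-(\mathds{1}+tH)^{-1}\|\le M_\rho\left(\frac{\tau}{t}\right)^{\rho}$$ holds for all $0<\tau\le t<\infty$, then there exists a constant $c_\rho>0$ such that $$\sup_{t\in[0,\infty)}\|F(t/n)^n-e^{-tH}\|\le c_\rho\,\frac{1}{n^\rho}$$ holds for all integers $n\ge1$.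
   Context: $\mathcal{L}(\mathfrak{H})$ is the space of bounded linear operators on $\mathfrak{H}$, $\|\cdot\|$ is the operator norm, $\mathds{1}$ is the identity operator, and $\operatorname{s-lim}$ denotes the limit in the strong operator topology. *)

theory Defs
  imports "HOL-Analysis.Analysis" "HOL-Library.Nonpos_Ints"
begin

text \<open>The inner product is conjugate-linear in the first argument and linear in the second.
  The underlying real Banach space is the one obtained by restricting scalars, so the library's
  limits, measurability and operator norm \<^const>\<open>onorm\<close> apply; for complex-linear operators
  the latter coincides with the complex operator norm.\<close>

class complex_hilbert_space = banach +
  fixes scaleC :: "complex \<Rightarrow> 'a \<Rightarrow> 'a" (infixr "*\<^sub>C" 75)
    and cinner :: "'a \<Rightarrow> 'a \<Rightarrow> complex"
  assumes scaleC_add_right: "c *\<^sub>C (x + y) = c *\<^sub>C x + c *\<^sub>C y"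
    and scaleC_add_left: "(c + d) *\<^sub>C x = c *\<^sub>C x + d *\<^sub>C x"
    and scaleC_scaleC: "c *\<^sub>C d *\<^sub>C x = (c * d) *\<^sub>C x"
    and scaleR_scaleC: "r *\<^sub>R x = complex_of_real r *\<^sub>C x"
    and cinner_commute: "cinner x y = cnj (cinner y x)"
    and cinner_add_right: "cinner x (y + z) = cinner x y + cinner x z"
    and cinner_scaleC_right: "cinner x (c *\<^sub>C y) = c * cinner x y"
    and cinner_self: "cinner x x = complex_of_real ((norm x)\<^sup>2)"

instantiation complex :: complex_hilbert_space
begin

definition scaleC_complex :: "complex \<Rightarrow> complex \<Rightarrow> complex"
  where "scaleC_complex c x = c * x"

definition cinner_complex :: "complex \<Rightarrow> complex \<Rightarrow> complex"
  where "cinner_complex x y = cnj x * y"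

instance
proof
  fix x :: complex
  show "cinner x x = complex_of_real ((norm x)\<^sup>2)"
    by (metis cinner_complex_def complex_norm_square mult.commute of_real_power)
qed (simp_all add: scaleC_complex_def cinner_complex_def algebra_simps scaleR_conv_of_real)

end

definition bounded_clinear :: "('a::complex_hilbert_space \<Rightarrow> 'a) \<Rightarrow> bool"
  where "bounded_clinear A \<longleftrightarrow> bounded_linear A \<and> (\<forall>c x. A (c *\<^sub>C x) = c *\<^sub>C A x)"

text \<open>A possibly unbounded operator is given by its domain \<open>D\<close> and a function \<open>A\<close> whose values
  outside \<open>D\<close> are irrelevant. An everywhere defined operator has domain \<^term>\<open>UNIV\<close>.\<close>

definition linear_operator :: "'a::complex_hilbert_space set \<Rightarrow> ('a \<Rightarrow> 'a) \<Rightarrow> bool"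
  where "linear_operator D A \<longleftrightarrow>
    0 \<in> D \<and> (\<forall>x\<in>D. \<forall>y\<in>D. x + y \<in> D \<and> A (x + y) = A x + A y) \<and>
    (\<forall>c. \<forall>x\<in>D. c *\<^sub>C x \<in> D \<and> A (c *\<^sub>C x) = c *\<^sub>C A x)"

definition adjoint_domain :: "'a::complex_hilbert_space set \<Rightarrow> ('a \<Rightarrow> 'a) \<Rightarrow> 'a set"
  where "adjoint_domain D A = {y. \<exists>z. \<forall>x\<in>D. cinner (A x) y = cinner x z}"

text \<open>The vector \<open>z\<close> is unique when \<open>D\<close> is dense.\<close>

definition adjoint_operator ::
    "'a::complex_hilbert_space set \<Rightarrow> ('a \<Rightarrow> 'a) \<Rightarrow> 'a \<Rightarrow> 'a"
  where "adjoint_operator D A y = (THE z. \<forall>x\<in>D. cinner (A x) y = cinner x z)"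

definition selfadjoint_operator :: "'a::complex_hilbert_space set \<Rightarrow> ('a \<Rightarrow> 'a) \<Rightarrow> bool"
  where "selfadjoint_operator D A \<longleftrightarrow>
    linear_operator D A \<and> closure D = UNIV \<and>
    adjoint_domain D A = D \<and> (\<forall>x\<in>D. adjoint_operator D A x = A x)"

definition nonneg_operator :: "'a::complex_hilbert_space set \<Rightarrow> ('a \<Rightarrow> 'a) \<Rightarrow> bool"
  where "nonneg_operator D A \<longleftrightarrow> (\<forall>x\<in>D. cinner x (A x) \<in> \<real>\<^sub>\<ge>\<^sub>0)"

text \<open>\<open>(\<one> + t A)\<^sup>-\<^sup>1\<close>; the map \<open>x \<mapsto> x + t A x\<close> is a bijection from \<open>D\<close> onto the whole space
  whenever \<open>A\<close> is self-adjoint and non-negative and \<open>t \<ge> 0\<close>.\<close>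

definition resolvent_inv ::
    "'a::complex_hilbert_space set \<Rightarrow> ('a \<Rightarrow> 'a) \<Rightarrow> real \<Rightarrow> 'a \<Rightarrow> 'a"
  where "resolvent_inv D A t = inv_into D (\<lambda>x. x + t *\<^sub>R A x)"

definition C0_semigroup :: "(real \<Rightarrow> 'a::complex_hilbert_space \<Rightarrow> 'a) \<Rightarrow> bool"
  where "C0_semigroup T \<longleftrightarrow>
    (\<forall>t\<ge>0. bounded_clinear (T t)) \<and> T 0 = id \<and>
    (\<forall>s\<ge>0. \<forall>t\<ge>0. T (s + t) = T s \<circ> T t) \<and>
    (\<forall>x. ((\<lambda>t. T t x) \<longlongrightarrow> x) (at_right 0))"

definition has_generator ::
    "(real \<Rightarrow> 'a::complex_hilbert_space \<Rightarrow> 'a) \<Rightarrow> 'a set \<Rightarrow> ('a \<Rightarrow> 'a) \<Rightarrow> bool"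
  where "has_generator T D A \<longleftrightarrow>
    D = {x. \<exists>y. ((\<lambda>h. (T h x - x) /\<^sub>R h) \<longlongrightarrow> y) (at_right 0)} \<and>
    (\<forall>x\<in>D. ((\<lambda>h. (T h x - x) /\<^sub>R h) \<longlongrightarrow> A x) (at_right 0))"

text \<open>For \<open>t \<ge> 0\<close> this is \<open>e\<^sup>t\<^sup>A\<close>, where \<open>A\<close> (with domain \<open>D\<close>) generates a strongly continuous
  semigroup. The description ranges over the value at \<open>t\<close> rather than over the semigroup, because
  \<open>T\<close> is unconstrained at negative times.\<close>

definition semigroup_exp ::
    "'a::complex_hilbert_space set \<Rightarrow> ('a \<Rightarrow> 'a) \<Rightarrow> real \<Rightarrow> 'a \<Rightarrow> 'a"
  where "semigroup_exp D A t = (THE U. \<exists>T. C0_semigroup T \<and> has_generator T D A \<and> U = T t)"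

end

theory Submission
  imports Defs
begin

text \<open>Fix \<open>t > 0\<close> and \<open>n\<close>, put \<open>\<tau> = t / n\<close>, and write \<open>F\<close> for \<open>F(\<tau>)\<close>,
  \<open>\<Theta> = e\<^sup>-\<^sup>\<tau>\<^sup>H\<close>, \<open>P = (1 + t S(\<tau>))\<^sup>-\<^sup>1\<close> and
  \<open>Q = (1 + t H)\<^sup>-\<^sup>1\<close>. The hypothesis at the pair \<open>\<tau>, t\<close> is
  \<open>\<parallel>P - Q\<parallel> \<le> \<delta>\<close> with \<open>\<delta> = M n\<^sup>-\<^sup>\<rho>\<close>, and the claim is
  \<open>\<parallel>F\<^sup>n - \<Theta>\<^sup>n\<parallel> = O(\<delta> + 1/n)\<close>. The function \<open>e\<^sup>-\<^sup>x\<close> is a smooth function of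
  \<open>(1 + x)\<^sup>-\<^sup>1\<close>, so one expects an operator-Lipschitz bound; it is obtained here from two
  elementary facts, without spectral calculus or contour integrals.

  \<^item> In weighted form the difference is small. Since \<open>F = 1 - t S(\<tau>) / n\<close> exactly and
    \<open>\<Theta> = 1 - t H / n + O(t\<^sup>2 H\<^sup>2 / n\<^sup>2)\<close> on the domain of \<open>H\<^sup>2\<close>, and
    \<open>P (t H - t S(\<tau>)) Q = P - Q\<close>, one has \<open>P (F - \<Theta>) Q\<^sup>2 = O(\<delta>/n + 1/n\<^sup>2)\<close>.
    Telescoping, and commuting the resolvents past the powers at the cost of a further multiple of
    \<open>\<delta>\<close>, gives \<open>Z Q\<^sup>3 = O(\<delta> + 1/n)\<close> and \<open>Z P\<^sup>3 = O(\<delta> + 1/n)\<close> for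
    \<open>Z = F\<^sup>m - \<Theta>\<^sup>m\<close> with \<open>m \<le> n\<close> (\<open>weighted_power_comparison\<close>).
  \<^item> Powers smooth. A non-negative self-adjoint contraction satisfies
    \<open>\<parallel>K\<^sup>k (1 - K)\<parallel> \<le> 1 / (k + 1)\<close> (\<open>pos_contraction_funpow_diff_le\<close>). Hence a power
    of \<open>F\<close> comparable to \<open>n\<close> absorbs the weight \<open>P\<^sup>-\<^sup>3\<close>, and a power of \<open>\<Theta>\<close>
    comparable to \<open>n\<close> absorbs \<open>Q\<^sup>-\<^sup>3\<close>.

  Splitting \<open>n = a + b\<close> into two comparable parts,
  \<open>F\<^sup>n - \<Theta>\<^sup>n = F\<^sup>a (F\<^sup>b - \<Theta>\<^sup>b) + (F\<^sup>a - \<Theta>\<^sup>a) \<Theta>\<^sup>b\<close>, and the smoothing factor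
  in each summand removes the weight in the bound for the other factor; this is
  \<open>power_semigroup_distance\<close>.

  The semigroup \<open>e\<^sup>-\<^sup>t\<^sup>H\<close> is built as the strong limit of the Euler products
  \<open>(1 + t 2\<^sup>-\<^sup>k H)\<close> to the power \<open>- 2\<^sup>k\<close>, which needs only that \<open>1 + H\<close> is onto. That in turn
  follows from the strong resolvent limit: for \<open>u = lim (1 + S(\<tau>))\<^sup>-\<^sup>1 y\<close> and \<open>x\<close> in the domain,
  passing to the limit in the symmetric operators \<open>(1 + S(\<tau>))\<^sup>-\<^sup>1\<close> gives
  \<open>\<langle>(1 + H) x, u\<rangle> = \<langle>x, y\<rangle>\<close>, and self-adjointness puts \<open>u\<close> in the domain with
  \<open>(1 + H) u = y\<close>.\<close>

section \<open>The real inner product\<close>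

text \<open>Only real parts of inner products are needed for estimates. Nothing is lost by this: the
  imaginary part of \<open>\<langle>x, y\<rangle>\<close> is the real inner product of \<open>\<i> x\<close> with \<open>y\<close>.\<close>
definition rinner :: "'a::complex_hilbert_space \<Rightarrow> 'a \<Rightarrow> real"
  where "rinner x y = Re (cinner x y)"

lemma rinner_commute: "rinner x y = rinner y x"
  unfolding rinner_def using arg_cong[OF cinner_commute[of x y], of Re] by simp

lemma rinner_add_right: "rinner x (y + z) = rinner x y + rinner x z"
  by (simp add: rinner_def cinner_add_right)

lemma rinner_add_left: "rinner (x + y) z = rinner x z + rinner y z"
  by (metis rinner_commute rinner_add_right)

lemma rinner_scaleR_right: "rinner x (r *\<^sub>R y) = r * rinner x y"
  by (simp add: rinner_def scaleR_scaleC cinner_scaleC_right)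

lemma rinner_scaleR_left: "rinner (r *\<^sub>R x) y = r * rinner x y"
  by (metis rinner_commute rinner_scaleR_right)

lemma rinner_minus_right: "rinner x (- y) = - rinner x y"
  using rinner_scaleR_right[of x "-1" y] by simp

lemma rinner_minus_left: "rinner (- x) y = - rinner x y"
  by (metis rinner_commute rinner_minus_right)

lemma rinner_diff_right: "rinner x (y - z) = rinner x y - rinner x z"
  using rinner_add_right[of x y "- z"] by (simp add: rinner_minus_right)

lemma rinner_diff_left: "rinner (x - y) z = rinner x z - rinner y z"
  by (metis rinner_commute rinner_diff_right)

lemma rinner_zero_right [simp]: "rinner x 0 = 0"
  using rinner_scaleR_right[of x 0 0] by simp

lemma rinner_zero_left [simp]: "rinner 0 x = 0"
  by (metis rinner_commute rinner_zero_right)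

lemmas rinner_simps = rinner_add_right rinner_add_left rinner_scaleR_right rinner_scaleR_left
  rinner_minus_right rinner_minus_left rinner_diff_right rinner_diff_left

lemma rinner_self: "rinner x x = (norm x)\<^sup>2"
  by (simp add: rinner_def cinner_self)

lemma rinner_le_norm: "rinner x y \<le> norm x * norm y"
proof (cases "x = 0 \<or> y = 0")
  case True
  then show ?thesis by auto
next
  case False
  then have pos: "norm x > 0" "norm y > 0" by auto
  have "0 \<le> rinner (norm y *\<^sub>R x - norm x *\<^sub>R y) (norm y *\<^sub>R x - norm x *\<^sub>R y)"
    by (simp add: rinner_self)
  also have "\<dots> = 2 * (norm x * norm y) * (norm x * norm y - rinner x y)"
    unfolding rinner_diff_left rinner_diff_right rinner_scaleR_left rinner_scaleR_right
    by (simp add: rinner_self rinner_commute[of y x] power2_eq_square algebra_simps)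
  finally show ?thesis using pos
    using mult_pos_pos[OF pos] by (smt (verit) zero_le_mult_iff)
qed

lemma abs_rinner_le_norm: "\<bar>rinner x y\<bar> \<le> norm x * norm y"
  using rinner_le_norm[of x y] rinner_le_norm[of "- x" y] by (simp add: rinner_minus_left)

lemma bounded_bilinear_rinner: "bounded_bilinear rinner"
  by unfold_locales (auto simp: rinner_simps intro!: exI[of _ 1] abs_rinner_le_norm)

lemma cinner_scaleC_left: "cinner (c *\<^sub>C x) y = cnj c * cinner x y"
  by (metis cinner_commute cinner_scaleC_right complex_cnj_cnj complex_cnj_mult)

lemma Im_cinner_eq_rinner: "Im (cinner x y) = rinner (\<i> *\<^sub>C x) y"
  by (simp add: rinner_def cinner_scaleC_left)

lemma norm_scaleC: "norm (c *\<^sub>C x) = cmod c * norm x"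
proof -
  have "complex_of_real ((norm (c *\<^sub>C x))\<^sup>2) = (c * cnj c) * complex_of_real ((norm x)\<^sup>2)"
    unfolding cinner_self[symmetric] cinner_scaleC_left cinner_scaleC_right by simp
  also have "\<dots> = complex_of_real ((cmod c * norm x)\<^sup>2)"
    by (simp add: complex_norm_square power_mult_distrib del: of_real_power flip: of_real_power)
  finally have "(norm (c *\<^sub>C x))\<^sup>2 = (cmod c * norm x)\<^sup>2"
    using of_real_eq_iff by blast
  then show ?thesis
    by (simp add: power2_eq_iff_nonneg)
qed

lemma bounded_linear_scaleC: "bounded_linear (\<lambda>x. c *\<^sub>C x)"
proof (rule bounded_linear_intro[where K = "cmod c"])
  show "c *\<^sub>C (r *\<^sub>R x) = r *\<^sub>R (c *\<^sub>C x)" for r and x :: 'a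
    by (simp add: scaleR_scaleC scaleC_scaleC mult.commute)
qed (auto simp: scaleC_add_right norm_scaleC mult.commute)

section \<open>Non-negative self-adjoint contractions and smoothing\<close>

text \<open>Symmetry for the real inner product amounts to complex self-adjointness, because the operator
  is complex-linear.\<close>
definition pos_contraction :: "('a::complex_hilbert_space \<Rightarrow> 'a) \<Rightarrow> bool"
  where "pos_contraction K \<longleftrightarrow> bounded_clinear K \<and> (\<forall>x y. rinner (K x) y = rinner x (K y)) \<and>
    (\<forall>x. 0 \<le> rinner x (K x)) \<and> (\<forall>x. norm (K x) \<le> norm x)"

lemma bounded_clinear_imp_linear: "bounded_clinear K \<Longrightarrow> linear K"
  by (simp add: bounded_clinear_def bounded_linear.linear)

lemma
  assumes "pos_contraction K"
  shows pos_contraction_bounded_clinear: "bounded_clinear K"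
    and pos_contraction_linear: "linear K"
    and pos_contraction_bounded_linear: "bounded_linear K"
    and pos_contraction_symmetric: "rinner (K x) y = rinner x (K y)"
    and pos_contraction_nonneg: "0 \<le> rinner x (K x)"
    and pos_contraction_norm: "norm (K x) \<le> norm x"
  using assms by (auto simp: pos_contraction_def bounded_clinear_imp_linear bounded_clinear_def)

lemma linear_funpow: "linear K \<Longrightarrow> linear (K ^^ n)"
  for K :: "'a::real_vector \<Rightarrow> 'a"
  by (induction n) (auto simp: linear_iff)

lemma norm_funpow_le:
  fixes K :: "'a::real_normed_vector \<Rightarrow> 'a"
  assumes "\<And>x. norm (K x) \<le> norm x"
  shows "norm ((K ^^ n) x) \<le> norm x"
  by (induction n) (use assms in \<open>auto intro: order_trans\<close>)

lemma rinner_funpow_symmetric: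
  assumes "\<And>x y. rinner (K x) y = rinner x (K y)"
  shows "rinner ((K ^^ n) x) y = rinner x ((K ^^ n) y)"
  by (induction n arbitrary: x y) (auto simp: assms funpow_swap1)

lemma funpow_commute:
  assumes "\<And>x. f (g x) = g (f x)"
  shows "(f ^^ n) (g x) = g ((f ^^ n) x)"
  by (induction n) (auto simp: assms)

lemma adjoint_norm_le:
  fixes K L :: "'a::complex_hilbert_space \<Rightarrow> 'a"
  assumes bound: "\<And>x. norm (K x) \<le> c * norm x"
    and adj: "\<And>x y. rinner (K x) y = rinner x (L y)"
  shows "norm (L y) \<le> c * norm y"
proof (cases "L y = 0")
  case True
  have "0 \<le> c * norm y" using bound[of y] norm_ge_zero order_trans by blast
  with True show ?thesis by simp
next
  case False
  have "(norm (L y))\<^sup>2 = rinner (K (L y)) y"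
    by (simp add: rinner_self adj)
  also have "\<dots> \<le> (c * norm (L y)) * norm y"
    using order_trans[OF rinner_le_norm[of "K (L y)" y]
        mult_right_mono[OF bound[of "L y"] norm_ge_zero[of y]]] .
  finally show ?thesis using False by (simp add: power2_eq_square)
qed

text \<open>All monomials \<open>x\<^sup>j (1 - x)\<^sup>i\<close> yield non-negative operators. Splitting off the even parts of both
  exponents reduces this to the four monomials with exponents \<open>0\<close> or \<open>1\<close>.\<close>
lemma rinner_funpow_diff_nonneg:
  assumes K: "pos_contraction K"
  shows "0 \<le> rinner y ((K ^^ j) (((\<lambda>x. x - K x) ^^ i) y))"
proof -
  let ?C = "\<lambda>x. x - K x"
  note lin = pos_contraction_linear[OF K] and sym = pos_contraction_symmetric[OF K]
  have symC: "rinner (?C x) y = rinner x (?C y)" for x y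
    by (simp add: rinner_simps sym)
  have comm: "K (?C x) = ?C (K x)" for x
    by (simp add: linear_diff[OF lin])
  have commC: "K ((?C ^^ n) x) = (?C ^^ n) (K x)" for n x
    using funpow_commute[where f = ?C and g = K, of n x] comm by simp
  have commP: "(K ^^ m) ((?C ^^ n) x) = (?C ^^ n) ((K ^^ m) x)" for m n x
    using funpow_commute[where f = K and g = "?C ^^ n", OF commC, of m x] by simp
  have posC: "0 \<le> rinner x (?C x)" for x
  proof -
    have "rinner x (K x) \<le> norm x * norm x"
      using rinner_le_norm[of x "K x"] pos_contraction_norm[OF K, of x]
      by (meson mult_left_mono norm_ge_zero order_trans)
    then show ?thesis by (simp add: rinner_simps rinner_self power2_eq_square)
  qed
  have posKC: "0 \<le> rinner x (K (?C x))" for x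
  proof -
    \<comment> \<open>The identity \<open>K (1 - K) = K (1 - K) K + (1 - K) K (1 - K)\<close> exhibits the product as a sum of
      non-negative operators.\<close>
    have "rinner x (K (?C x)) = rinner (K x) (?C (K x)) + rinner (?C x) (K (?C x))"
      by (simp add: rinner_simps linear_diff[OF lin] sym)
    then show ?thesis
      using posC[of "K x"] pos_contraction_nonneg[OF K, of "?C x"] by linarith
  qed
  have half: "rinner y ((K ^^ (m + m + p)) ((?C ^^ (n + n + q)) y))
      = rinner ((K ^^ m) ((?C ^^ n) y)) ((K ^^ p) ((?C ^^ q) ((K ^^ m) ((?C ^^ n) y))))" for m n p q
  proof -
    have "(K ^^ (m + m + p)) ((?C ^^ (n + n + q)) y)
        = (K ^^ m) ((K ^^ p) ((K ^^ m) ((?C ^^ n) ((?C ^^ q) ((?C ^^ n) y)))))"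
    proof -
      have "m + m + p = m + (p + m)" "n + n + q = n + (q + n)" by simp_all
      then show ?thesis by (simp only: funpow_add o_apply)
    qed
    also have "\<dots> = (K ^^ m) ((?C ^^ n) ((K ^^ p) ((?C ^^ q) ((K ^^ m) ((?C ^^ n) y)))))"
      by (simp only: commP)
    finally show ?thesis
      by (simp only: rinner_funpow_symmetric[OF symC] rinner_funpow_symmetric[OF sym] commP)
  qed
  have parity: "\<exists>m p. j = m + m + p \<and> p \<in> {0, 1}" for j :: nat
  proof (intro exI conjI)
    show "j = j div 2 + j div 2 + j mod 2" by presburger
    show "j mod 2 \<in> {0, 1}" by auto
  qed
  obtain m p where j: "j = m + m + p" "p \<in> {0, 1}" using parity by blast
  obtain n q where i: "i = n + n + q" "q \<in> {0, 1}" using parity by blast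
  show ?thesis
    unfolding j(1) i(1) half using j(2) i(2) posC posKC pos_contraction_nonneg[OF K]
    by (auto simp: rinner_self)
qed

text \<open>This is the operator form of \<open>x\<^sup>k (1 - x) \<le> 1 / (k + 1)\<close> on \<open>[0, 1]\<close>. The moments
  \<open>b j = \<langle>y, K\<^sup>j y\<rangle>\<close> are completely monotone, and the square of the norm in question is the
  second difference \<open>w\<close> of \<open>b\<close> at \<open>2 k\<close>. Since \<open>w\<close> decreases while
  \<open>\<Sum> (j + 1) w j\<close> is bounded by \<open>b 0\<close> through summation by parts, \<open>w\<close> decays
  quadratically.\<close>
lemma pos_contraction_funpow_diff_le:
  assumes K: "pos_contraction K"
  shows "norm ((K ^^ k) (y - K y)) \<le> norm y / (real k + 1)"
proof -
  note lin = pos_contraction_linear[OF K] and sym = pos_contraction_symmetric[OF K]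
  define b where "b j = rinner y ((K ^^ j) y)" for j
  define w where "w j = b j - 2 * b (j + 1) + b (j + 2)" for j
  have w_eq: "w j = rinner y ((K ^^ j) (((\<lambda>x. x - K x) ^^ 2) y))" for j
    by (simp add: w_def b_def numeral_2_eq_2 linear_diff[OF lin] linear_diff[OF linear_funpow[OF lin]]
        rinner_simps funpow_swap1)
  have dec: "w (Suc j) \<le> w j" for j
    using rinner_funpow_diff_nonneg[OF K, of y j 3]
    by (simp add: w_eq numeral_2_eq_2 numeral_3_eq_3 linear_diff[OF lin]
        linear_diff[OF linear_funpow[OF lin]] rinner_simps funpow_swap1)
  have b_nonneg: "0 \<le> b j" for j
    using rinner_funpow_diff_nonneg[OF K, of y j 0] by (simp add: b_def)
  have b_dec: "b (Suc j) \<le> b j" for j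
    using rinner_funpow_diff_nonneg[OF K, of y j 1]
    by (simp add: b_def linear_diff[OF linear_funpow[OF lin]] rinner_simps funpow_swap1)
  \<comment> \<open>Summation by parts.\<close>
  have sum_w: "(\<Sum>j\<le>m. (real j + 1) * w j) = b 0 - (real m + 2) * b (m + 1) + (real m + 1) * b (m + 2)" for m
    by (induction m) (simp_all add: w_def algebra_simps)
  have anti: "w m \<le> w j" if "j \<le> m" for j m
    using lift_Suc_antimono_le[of w, OF dec that] .
  have gauss: "(\<Sum>j\<le>m. real j + 1) = (real m + 1) * (real m + 2) / 2" for m
    by (induction m) (simp_all add: field_simps)
  have w_le: "(real m + 1) * (real m + 2) / 2 * w m \<le> (norm y)\<^sup>2" for m
  proof -
    have "(real m + 1) * (real m + 2) / 2 * w m = (\<Sum>j\<le>m. (real j + 1) * w m)"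
      by (simp add: gauss flip: sum_distrib_right)
    also have "\<dots> \<le> (\<Sum>j\<le>m. (real j + 1) * w j)"
      by (intro sum_mono mult_left_mono anti) auto
    also have "\<dots> = b 0 - b (m + 1) - (real m + 1) * (b (m + 1) - b (m + 2))"
      unfolding sum_w by (simp add: algebra_simps)
    also have "\<dots> \<le> b 0"
    proof -
      have "0 \<le> (real m + 1) * (b (m + 1) - b (m + 2))"
        using b_dec[of "m + 1"] by (intro mult_nonneg_nonneg) simp_all
      then show ?thesis using b_nonneg[of "m + 1"] by linarith
    qed
    also have "b 0 = (norm y)\<^sup>2" by (simp add: b_def rinner_self)
    finally show ?thesis .
  qed
  have sq: "(norm ((K ^^ k) (y - K y)))\<^sup>2 = w (k + k)"
  proof -
    have "(norm ((K ^^ k) (y - K y)))\<^sup>2 = rinner (y - K y) ((K ^^ (k + k)) (y - K y))"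
      unfolding rinner_self[symmetric] rinner_funpow_symmetric[OF sym] funpow_add o_apply ..
    also have "\<dots> = w (k + k)"
      unfolding w_def b_def linear_diff[OF linear_funpow[OF lin]] rinner_simps sym
      by (simp add: funpow_swap1)
    finally show ?thesis .
  qed
  have "0 \<le> w (k + k)" unfolding sq[symmetric] by simp
  moreover have "(real k + 1)\<^sup>2 \<le> (real (k + k) + 1) * (real (k + k) + 2) / 2"
    by (simp add: power2_eq_square algebra_simps)
  ultimately have "(real k + 1)\<^sup>2 * w (k + k) \<le> (real (k + k) + 1) * (real (k + k) + 2) / 2 * w (k + k)"
    by (intro mult_right_mono)
  also have "\<dots> \<le> (norm y)\<^sup>2" by (rule w_le)
  finally have "((real k + 1) * norm ((K ^^ k) (y - K y)))\<^sup>2 \<le> (norm y)\<^sup>2"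
    by (simp only: power_mult_distrib sq)
  then have "(real k + 1) * norm ((K ^^ k) (y - K y)) \<le> norm y"
    by (rule power2_le_imp_le) simp
  then show ?thesis by (simp add: field_simps)
qed

section \<open>Resolvents of a non-negative self-adjoint operator\<close>

lemma linear_operator_scaleR:
  assumes "linear_operator D A" "x \<in> D"
  shows "r *\<^sub>R x \<in> D \<and> A (r *\<^sub>R x) = r *\<^sub>R A x"
  using assms by (simp add: linear_operator_def scaleR_scaleC)

locale nonneg_symmetric =
  fixes D :: "'a::complex_hilbert_space set" and A :: "'a \<Rightarrow> 'a"
  assumes lin_op: "linear_operator D A"
    and symmetric: "x \<in> D \<Longrightarrow> y \<in> D \<Longrightarrow> rinner (A x) y = rinner x (A y)"
    and nonneg: "x \<in> D \<Longrightarrow> 0 \<le> rinner x (A x)"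
    and dense: "closure D = UNIV"
begin

lemma
  assumes "x \<in> D"
  shows D_add: "y \<in> D \<Longrightarrow> x + y \<in> D" and A_add: "y \<in> D \<Longrightarrow> A (x + y) = A x + A y"
    and D_scaleC: "c *\<^sub>C x \<in> D" and A_scaleC: "A (c *\<^sub>C x) = c *\<^sub>C A x"
    and D_scaleR: "r *\<^sub>R x \<in> D" and A_scaleR: "A (r *\<^sub>R x) = r *\<^sub>R A x"
  using assms lin_op linear_operator_scaleR[OF lin_op assms] by (auto simp: linear_operator_def)

lemma
  assumes "x \<in> D" "y \<in> D"
  shows D_diff: "x - y \<in> D" and A_diff: "A (x - y) = A x - A y"
  using D_add[OF assms(1) D_scaleR[OF assms(2), of "-1"]] A_add[OF assms(1) D_scaleR[OF assms(2), of "-1"]]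
    A_scaleR[OF assms(2), of "-1"] by simp_all

lemma
  assumes x: "x \<in> D" and s: "0 \<le> s"
  shows norm_le_norm_shift: "norm x \<le> norm (x + s *\<^sub>R A x)"
    and norm_A_le_norm_shift: "norm (s *\<^sub>R A x) \<le> norm (x + s *\<^sub>R A x)"
proof -
  have "(norm (x + s *\<^sub>R A x))\<^sup>2 = (norm x)\<^sup>2 + 2 * s * rinner x (A x) + (norm (s *\<^sub>R A x))\<^sup>2"
    unfolding rinner_self[symmetric] rinner_simps
    by (simp add: rinner_commute[of "A x" x] algebra_simps)
  moreover have "0 \<le> s * rinner x (A x)" using nonneg[OF x] s by simp
  ultimately have "(norm x)\<^sup>2 \<le> (norm (x + s *\<^sub>R A x))\<^sup>2"
    "(norm (s *\<^sub>R A x))\<^sup>2 \<le> (norm (x + s *\<^sub>R A x))\<^sup>2"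
    using zero_le_power2[of "norm x"] zero_le_power2[of "norm (s *\<^sub>R A x)"] by linarith+
  then show "norm x \<le> norm (x + s *\<^sub>R A x)" "norm (s *\<^sub>R A x) \<le> norm (x + s *\<^sub>R A x)"
    by (auto intro: power2_le_imp_le)
qed

lemma inj_on_shift:
  assumes "0 \<le> s" shows "inj_on (\<lambda>x. x + s *\<^sub>R A x) D"
proof (rule inj_onI)
  fix x y assume xy: "x \<in> D" "y \<in> D" and eq: "x + s *\<^sub>R A x = y + s *\<^sub>R A y"
  have "(x - y) + s *\<^sub>R A (x - y) = 0"
    using eq by (simp add: A_diff[OF xy] algebra_simps)
  then show "x = y" using norm_le_norm_shift[OF D_diff[OF xy] assms] by simp
qed

lemma resolvent_inv_shift:
  "0 \<le> s \<Longrightarrow> x \<in> D \<Longrightarrow> resolvent_inv D A s (x + s *\<^sub>R A x) = x"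
  using inv_into_f_f[OF inj_on_shift[of s], of x] by (simp add: resolvent_inv_def)

end

text \<open>A densely defined non-negative symmetric operator is self-adjoint if \<open>1 + A\<close> is onto; in this
  form the condition can be verified and used without mentioning the adjoint.\<close>
locale nonneg_selfadjoint = nonneg_symmetric +
  assumes one_plus_onto: "\<exists>x\<in>D. x + A x = y"
begin

text \<open>With \<open>R = (1 + A)\<^sup>-\<^sup>1\<close>, solving \<open>x + s A x = y\<close> for \<open>x = R z\<close> means
  \<open>s z + (1 - s) R z = y\<close>. Both \<open>R\<close> and \<open>1 - R\<close> are contractions, so for \<open>s \<le> 1\<close> and for
  \<open>s > 1\<close> a suitable rearrangement is a fixed point equation for a strict contraction.\<close>
lemma shift_onto:
  assumes s: "0 < s" shows "\<exists>x\<in>D. x + s *\<^sub>R A x = y"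
proof -
  obtain R where R: "\<And>z. R z \<in> D" "\<And>z. R z + A (R z) = z"
    using one_plus_onto by metis
  have R_lip: "norm (R z - R z') \<le> norm (z - z')"
    and AR_lip: "norm (A (R z) - A (R z')) \<le> norm (z - z')" for z z'
  proof -
    have "R z - R z' + A (R z - R z') = z - z'"
      using R(2)[of z] R(2)[of z'] by (simp add: A_diff R(1) algebra_simps)
    then show "norm (R z - R z') \<le> norm (z - z')" "norm (A (R z) - A (R z')) \<le> norm (z - z')"
      using norm_le_norm_shift[of "R z - R z'" 1] norm_A_le_norm_shift[of "R z - R z'" 1]
      by (simp_all add: D_diff A_diff R(1))
  qed
  have "\<exists>z. R z + s *\<^sub>R A (R z) = y"
  proof (cases "s \<le> 1")
    case True
    let ?f = "\<lambda>z. y + (1 - s) *\<^sub>R A (R z)"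
    have "\<exists>!z. ?f z = z"
    proof (rule banach_fix_type[of "1 - s"], use True s in simp, use s in simp, intro allI)
      fix z z'
      have "dist (?f z) (?f z') = (1 - s) * norm (A (R z) - A (R z'))"
        using True by (simp add: dist_norm flip: scaleR_right_diff_distrib)
      also have "\<dots> \<le> (1 - s) * dist z z'"
        using AR_lip True by (simp add: dist_norm mult_left_mono)
      finally show "dist (?f z) (?f z') \<le> (1 - s) * dist z z'" .
    qed
    then obtain z where z: "?f z = z" by blast
    have "R z + s *\<^sub>R A (R z) = z - (1 - s) *\<^sub>R A (R z)"
      using R(2)[of z] by (simp add: algebra_simps)
    also have "\<dots> = y" using z by (metis add_diff_cancel_right')
    finally show ?thesis by blast
  next
    case False
    let ?f = "\<lambda>z. (1 / s) *\<^sub>R y + (1 - 1 / s) *\<^sub>R R z"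
    have q: "0 \<le> 1 - 1 / s" "1 - 1 / s < 1" using False by simp_all
    have "\<exists>!z. ?f z = z"
    proof (rule banach_fix_type[OF q], intro allI)
      fix z z'
      have "dist (?f z) (?f z') = (1 - 1 / s) * norm (R z - R z')"
        using q by (simp add: dist_norm flip: scaleR_right_diff_distrib)
      also have "\<dots> \<le> (1 - 1 / s) * dist z z'"
        unfolding dist_norm using R_lip q(1) by (rule mult_left_mono)
      finally show "dist (?f z) (?f z') \<le> (1 - 1 / s) * dist z z'" .
    qed
    then obtain z where z: "?f z = z" by blast
    have "R z + s *\<^sub>R A (R z) = s *\<^sub>R (R z + A (R z)) - (s - 1) *\<^sub>R R z"
      by (simp add: algebra_simps)
    also have "\<dots> = s *\<^sub>R ?f z - (s - 1) *\<^sub>R R z" using R(2) z by simp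
    also have "\<dots> = y" using s by (simp add: scaleR_add_right right_diff_distrib)
    finally show ?thesis by blast
  qed
  then show ?thesis using R(1) by blast
qed

text \<open>\<open>G s\<close> is the resolvent \<open>(1 + s A)\<^sup>-\<^sup>1\<close>. At \<open>s = 0\<close> the inverse of the identity on
  \<open>D\<close> is extended to the whole space, so that the algebra below holds for all \<open>s \<ge> 0\<close>.\<close>
definition G :: "real \<Rightarrow> 'a \<Rightarrow> 'a"
  where "G s = (if s = 0 then id else resolvent_inv D A s)"

lemma G_0 [simp]: "G 0 x = x"
  by (simp add: G_def)

lemma
  assumes s: "0 < s"
  shows G_in_D: "G s y \<in> D" and G_eq: "G s y + s *\<^sub>R A (G s y) = y"
proof -
  have "y \<in> (\<lambda>x. x + s *\<^sub>R A x) ` D" using shift_onto[OF s, of y] by auto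
  then show "G s y \<in> D" "G s y + s *\<^sub>R A (G s y) = y"
    using s inv_into_into[of y "\<lambda>x. x + s *\<^sub>R A x" D] f_inv_into_f[of y "\<lambda>x. x + s *\<^sub>R A x" D]
    by (simp_all add: G_def resolvent_inv_def)
qed

lemma G_shift: "0 \<le> s \<Longrightarrow> x \<in> D \<Longrightarrow> G s (x + s *\<^sub>R A x) = x"
  using resolvent_inv_shift[of s x] by (simp add: G_def)

lemma G_unique: "0 < s \<Longrightarrow> x \<in> D \<Longrightarrow> x + s *\<^sub>R A x = y \<Longrightarrow> G s y = x"
  using G_shift[of s x] by auto

lemma
  assumes s: "0 \<le> s"
  shows G_norm: "norm (G s y) \<le> norm y" and norm_diff_G: "norm (y - G s y) \<le> norm y"
proof -
  show "norm (G s y) \<le> norm y"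
    using s norm_le_norm_shift[OF G_in_D, of s s y] G_eq[of s y] by (cases "s = 0") auto
  have "y - G s y = s *\<^sub>R A (G s y)" if "s > 0" using G_eq[OF that, of y] by (simp add: algebra_simps)
  then show "norm (y - G s y) \<le> norm y"
    using s norm_A_le_norm_shift[OF G_in_D, of s s y] G_eq[of s y] by (cases "s = 0") auto
qed

lemma G_pos_contraction:
  assumes s: "0 \<le> s" shows "pos_contraction (G s)"
proof (cases "s = 0")
  case True
  have "G s = (\<lambda>x. x)" using True by (simp add: G_def fun_eq_iff)
  then show ?thesis by (simp add: pos_contraction_def bounded_clinear_def rinner_self)
next
  case False
  then have s: "0 < s" using s by simp
  have add: "G s (x + y) = G s x + G s y" for x y
    by (rule G_unique[OF s D_add[OF G_in_D[OF s] G_in_D[OF s]]])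
       (use G_eq[OF s, of x] G_eq[OF s, of y] in \<open>simp add: A_add G_in_D[OF s] algebra_simps\<close>)
  have scale: "G s (c *\<^sub>C x) = c *\<^sub>C G s x" for c x
    by (rule G_unique[OF s D_scaleC[OF G_in_D[OF s]]])
       (metis A_scaleC G_eq G_in_D s mult.commute scaleC_add_right scaleC_scaleC scaleR_scaleC)
  have "bounded_linear (G s)"
    by (rule bounded_linear_intro[where K = 1])
       (auto simp: add scale scaleR_scaleC G_norm s less_imp_le)
  moreover have "rinner (G s x) y = rinner x (G s y)" for x y
  proof -
    have "rinner (G s x) y = rinner (G s x) (G s y + s *\<^sub>R A (G s y))" by (simp add: G_eq s)
    also have "\<dots> = rinner (G s x + s *\<^sub>R A (G s x)) (G s y)"
      by (simp add: rinner_simps symmetric G_in_D s)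
    finally show ?thesis by (simp add: G_eq s)
  qed
  moreover have "0 \<le> rinner x (G s x)" for x
  proof -
    have "rinner x (G s x) = rinner (G s x + s *\<^sub>R A (G s x)) (G s x)" by (simp add: G_eq s)
    also have "\<dots> = (norm (G s x))\<^sup>2 + s * rinner (G s x) (A (G s x))"
      by (simp add: rinner_simps rinner_self rinner_commute)
    finally show ?thesis using nonneg[OF G_in_D[OF s], of x] s by simp
  qed
  ultimately show ?thesis
    using scale s by (simp add: pos_contraction_def bounded_clinear_def G_norm)
qed

lemmas G_linear = pos_contraction_linear[OF G_pos_contraction]

lemma
  assumes s: "0 \<le> s" and x: "x \<in> D"
  shows G_D: "G s x \<in> D" and A_G: "A (G s x) = G s (A x)"
proof -
  have "G s x \<in> D \<and> A (G s x) = G s (A x)"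
  proof (cases "s = 0")
    case True
    then show ?thesis using x by simp
  next
    case False
    then have s: "0 < s" using s by simp
    have "G s x + s *\<^sub>R G s (A x) = x"
      using G_shift[OF less_imp_le[OF s] x] s by (simp add: linear_add linear_scale G_linear)
    with G_eq[OF s, of x] have "s *\<^sub>R A (G s x) = s *\<^sub>R G s (A x)"
      by (metis add_left_cancel)
    then show ?thesis using s G_in_D[OF s] by simp
  qed
  then show "G s x \<in> D" "A (G s x) = G s (A x)" by auto
qed

lemma G_commute:
  assumes "0 \<le> s" "0 \<le> r" shows "G s (G r x) = G r (G s x)"
proof (cases "s = 0")
  case False
  then have s: "0 < s" using assms by simp
  have "G r x = G r (G s x + s *\<^sub>R A (G s x))" by (simp add: G_eq s)
  also have "\<dots> = G r (G s x) + s *\<^sub>R A (G r (G s x))"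
    by (simp add: linear_add linear_scale G_linear A_G G_in_D s assms)
  finally show ?thesis
    using G_shift[OF less_imp_le[OF s] G_D[OF assms(2) G_in_D[OF s]]] by simp
qed simp

text \<open>On the domain of \<open>A\<^sup>2\<close> all the Taylor estimates below are quadratic in time. It is a core: it is
  dense in \<open>D\<close> for the graph norm, since \<open>G 1\<close> maps \<open>D\<close> into it.\<close>
definition D2 :: "'a set" where "D2 = {x \<in> D. A x \<in> D}"

lemma D2_D: "x \<in> D2 \<Longrightarrow> x \<in> D" and D2_A: "x \<in> D2 \<Longrightarrow> A x \<in> D"
  by (auto simp: D2_def)

lemma G_D2: "0 \<le> s \<Longrightarrow> x \<in> D2 \<Longrightarrow> G s x \<in> D2"
  by (simp add: D2_def G_D A_G)

lemma A_G_eq: "A (G 1 z) = z - G 1 z"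
  using G_eq[of 1 z] by (simp add: algebra_simps)

lemma G_1_in_D2: "x \<in> D \<Longrightarrow> G 1 x \<in> D2"
  by (simp add: D2_def G_in_D A_G_eq D_diff)

lemma D2_core:
  assumes x: "x \<in> D" and e: "0 < e"
  shows "\<exists>x'\<in>D2. norm (x - x') < e \<and> norm (A x - A x') < e"
proof -
  define z where "z = x + A x"
  obtain z' where z': "z' \<in> D" "dist z' z < e"
    using dense e closure_approachable[of z D] by auto
  have x_eq: "x = G 1 z" using G_shift[of 1 x] x by (simp add: z_def)
  have "norm (x - G 1 z') \<le> norm (z - z')"
    unfolding x_eq using G_norm[of 1 "z - z'"] by (simp add: linear_diff[OF G_linear])
  moreover have "norm (A x - A (G 1 z')) \<le> norm (z - z')"
    unfolding x_eq A_G_eq using norm_diff_G[of 1 "z - z'"]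
    by (simp add: linear_diff[OF G_linear] algebra_simps)
  ultimately show ?thesis using z' G_1_in_D2[OF z'(1)]
    by (intro bexI[of _ "G 1 z'"]) (auto simp: dist_norm norm_minus_commute)
qed

lemma D2_dense: "closure D2 = UNIV"
proof -
  have "D \<subseteq> closure D2"
  proof
    fix x assume x: "x \<in> D"
    show "x \<in> closure D2"
      using D2_core[OF x] by (force simp: closure_approachable dist_norm norm_minus_commute)
  qed
  then show ?thesis using closure_mono[of D "closure D2"] dense by auto
qed

text \<open>The factors \<open>1 + s A\<close> multiply up to an error: \<open>(1 + a A) (1 + b A)\<close> exceeds
  \<open>1 + (a + b) A\<close> by \<open>a b A\<^sup>2\<close>. Hence
  \<open>G a G b - G (a + b) = - a b A\<^sup>2 G a G b G (a + b)\<close>. This one estimate gives the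
  convergence of the Euler products (with \<open>a = b\<close>) as well as the semigroup law of their limit.\<close>
lemma G_semigroup_defect:
  assumes a: "0 \<le> a" and b: "0 \<le> b" and x: "x \<in> D2"
  shows "norm (G a (G b x) - G (a + b) x) \<le> a * b * norm (A (A x))"
proof -
  have xD: "x \<in> D" and AxD: "A x \<in> D" using x by (auto simp: D2_def)
  have c: "0 \<le> a + b" using a b by simp
  define y where "y = G (a + b) x"
  have yD: "y \<in> D" and AyD: "A y \<in> D"
    using G_D[OF c xD] G_D[OF c AxD] A_G[OF c xD] by (simp_all add: y_def)
  have x_eq: "x = (y + b *\<^sub>R A y) + a *\<^sub>R A y"
  proof (cases "a + b = 0")
    case True
    then have "a = 0" "b = 0" using a b by auto
    then show ?thesis by (simp add: y_def)
  next
    case False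
    then show ?thesis using G_eq[of "a + b" x] c by (simp add: y_def algebra_simps)
  qed
  have "G b x = G b (y + b *\<^sub>R A y) + a *\<^sub>R G b (A y)"
    by (subst x_eq) (simp only: linear_add[OF G_linear[OF b]] linear_scale[OF G_linear[OF b]])
  then have "G b x = y + a *\<^sub>R G b (A y)"
    by (simp only: G_shift[OF b yD])
  then have "G a (G b x) = G a y + a *\<^sub>R G a (G b (A y))"
    by (simp add: linear_add[OF G_linear[OF a]] linear_scale[OF G_linear[OF a]])
  moreover have "y = G a y + a *\<^sub>R G a (A y)"
    using G_shift[OF a yD] by (simp add: linear_add[OF G_linear[OF a]] linear_scale[OF G_linear[OF a]])
  moreover have "A y = G b (A y) + b *\<^sub>R G b (A (A y))"
    using G_shift[OF b AyD] by (simp add: linear_add[OF G_linear[OF b]] linear_scale[OF G_linear[OF b]])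
  then have "G a (A y) = G a (G b (A y)) + b *\<^sub>R G a (G b (A (A y)))"
    by (metis linear_add[OF G_linear[OF a]] linear_scale[OF G_linear[OF a]])
  ultimately have "G a (G b x) - y = (G a y + a *\<^sub>R G a (G b (A y)))
      - (G a y + a *\<^sub>R (G a (G b (A y)) + b *\<^sub>R G a (G b (A (A y)))))"
    by (metis (no_types))
  also have "\<dots> = - (a * b) *\<^sub>R G a (G b (A (A y)))"
    by (simp add: scaleR_add_right)
  finally have "norm (G a (G b x) - y) = a * b * norm (G a (G b (A (A y))))"
    using a b by simp
  also have "\<dots> \<le> a * b * norm (A (A x))"
  proof -
    have "A (A y) = G (a + b) (A (A x))"
      unfolding y_def using A_G[OF c xD] A_G[OF c AxD] by simp
    then have "norm (G a (G b (A (A y)))) \<le> norm (A (A x))"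
      using order_trans[OF G_norm[OF a] order_trans[OF G_norm[OF b] G_norm[OF c]]] by simp
    then show ?thesis using a b by (intro mult_left_mono) auto
  qed
  finally show ?thesis by (simp add: y_def)
qed

end

section \<open>Limits of contractions\<close>

text \<open>Telescoping with an invariant set \<open>V\<close>, on which alone the single steps need to be close.\<close>
lemma norm_funpow_diff_le:
  fixes K L :: "'a::real_normed_vector \<Rightarrow> 'a"
  assumes K: "linear K" "\<And>y. norm (K y) \<le> norm y"
    and V: "\<And>y. y \<in> V \<Longrightarrow> L y \<in> V"
    and step: "\<And>y. y \<in> V \<Longrightarrow> norm (K y - L y) \<le> e"
    and x: "x \<in> V"
  shows "norm ((K ^^ n) x - (L ^^ n) x) \<le> real n * e"
  using x
proof (induction n arbitrary: x)
  case (Suc n)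
  have "(K ^^ Suc n) x - (L ^^ Suc n) x = (K ^^ n) (K x - L x) + ((K ^^ n) (L x) - (L ^^ n) (L x))"
    by (simp add: funpow_swap1 linear_diff[OF linear_funpow[OF K(1)]])
  also have "norm \<dots> \<le> norm (K x - L x) + real n * e"
    by (intro norm_triangle_mono norm_funpow_le K(2) Suc.IH V Suc.prems)
  also have "\<dots> \<le> real (Suc n) * e"
    using step[OF Suc.prems] by (simp add: algebra_simps)
  finally show ?case .
qed simp

lemma geometric_steps_converge:
  fixes X :: "nat \<Rightarrow> 'a::banach"
  assumes step: "\<And>k. norm (X (Suc k) - X k) \<le> c * (1/2) ^ k"
  shows "\<exists>L. X \<longlonglongrightarrow> L \<and> norm (L - X 0) \<le> 2 * c"
proof -
  let ?d = "\<lambda>k. X (Suc k) - X k"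
  have geo: "summable (\<lambda>k. c * (1/2) ^ k)" by (intro summable_mult summable_geometric) simp
  have sn: "summable (\<lambda>k. norm (?d k))"
    by (rule summable_comparison_test'[OF geo, of 0]) (use step in auto)
  have "(\<lambda>n. \<Sum>k<n. ?d k) \<longlonglongrightarrow> suminf ?d"
    using summable_norm_cancel[OF sn] by (rule summable_LIMSEQ)
  then have "(\<lambda>n. (X n - X 0) + X 0) \<longlonglongrightarrow> suminf ?d + X 0"
    unfolding sum_lessThan_telescope by (intro tendsto_add tendsto_const)
  moreover have "norm (suminf ?d) \<le> (\<Sum>k. c * (1/2) ^ k)"
    using summable_norm[OF sn] suminf_le[OF step sn geo] by linarith
  then have "norm (suminf ?d) \<le> 2 * c"
    by (simp add: suminf_mult suminf_geometric)
  ultimately show ?thesis by (intro exI[of _ "suminf ?d + X 0"]) simp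
qed

lemma contractions_convergent_dense:
  fixes E :: "nat \<Rightarrow> 'a::banach \<Rightarrow> 'a"
  assumes E: "\<And>k. linear (E k)" "\<And>k y. norm (E k y) \<le> norm y"
    and conv: "\<And>y. y \<in> S \<Longrightarrow> convergent (\<lambda>k. E k y)"
    and S: "closure S = UNIV"
  shows "convergent (\<lambda>k. E k x)"
proof (rule Cauchy_convergent, rule metric_CauchyI)
  fix e :: real assume e: "0 < e"
  obtain y where y: "y \<in> S" "dist y x < e / 3"
    using closure_approachable[of x S] S e by (metis UNIV_I divide_pos_pos zero_less_numeral)
  obtain N where N: "\<And>m n. m \<ge> N \<Longrightarrow> n \<ge> N \<Longrightarrow> dist (E m y) (E n y) < e / 3"
    using metric_CauchyD[OF convergent_Cauchy[OF conv[OF y(1)]], of "e / 3"] e by auto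
  have close: "dist (E k x) (E k y) < e / 3" for k
    using E(2)[of k "x - y"] y(2) by (simp add: dist_norm linear_diff[OF E(1)] norm_minus_commute)
  have "dist (E m x) (E n x) < e" if "m \<ge> N" "n \<ge> N" for m n
    using N[OF that] close[of m] close[of n] dist_triangle[of "E m x" "E n x" "E m y"]
      dist_triangle[of "E m y" "E n x" "E n y"] dist_commute[of "E n x" "E n y"] by linarith
  then show "\<exists>N. \<forall>m\<ge>N. \<forall>n\<ge>N. dist (E m x) (E n x) < e" by blast
qed

lemma continuous_eq_on_dense:
  fixes f g :: "'a::t2_space \<Rightarrow> 'b::t2_space"
  assumes "closure S = UNIV" "continuous_on UNIV f" "continuous_on UNIV g"
    and "\<And>y. y \<in> S \<Longrightarrow> f y = g y"
  shows "f x = g x"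
  using closure_minimal[of S "{x. f x = g x}"] closed_Collect_eq[OF assms(2,3)] assms by blast

lemma pos_contraction_continuous: "pos_contraction K \<Longrightarrow> continuous_on S K"
  using linear_continuous_on[OF pos_contraction_bounded_linear] .

lemma pos_contraction_limit:
  assumes E: "\<And>k. pos_contraction (E k)" and lim: "\<And>x. (\<lambda>k. E k x) \<longlonglongrightarrow> L x"
  shows "pos_contraction L"
proof -
  note bb = bounded_bilinear.tendsto[OF bounded_bilinear_rinner]
  have norm: "norm (L x) \<le> norm x" for x
    using tendsto_le[OF sequentially_bot tendsto_const tendsto_norm[OF lim]] E
    by (simp add: pos_contraction_norm)
  have add: "L (x + y) = L x + L y" for x y
    using LIMSEQ_unique[OF lim[of "x + y"]] tendsto_add[OF lim[of x] lim[of y]]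
    by (simp add: linear_add[OF pos_contraction_linear[OF E]])
  have scale: "L (c *\<^sub>C x) = c *\<^sub>C L x" for c x
    using LIMSEQ_unique[OF lim[of "c *\<^sub>C x"]]
      bounded_linear.tendsto[OF bounded_linear_scaleC lim[of x], of c] pos_contraction_bounded_clinear[OF E]
    by (simp add: bounded_clinear_def)
  have "bounded_linear L"
    by (rule bounded_linear_intro[where K = 1]) (auto simp: add scale scaleR_scaleC norm)
  moreover have "rinner (L x) y = rinner x (L y)" for x y
    using LIMSEQ_unique[OF bb[OF lim[of x] tendsto_const, of y]] bb[OF tendsto_const lim[of y], of x]
    by (simp add: pos_contraction_symmetric[OF E])
  moreover have "0 \<le> rinner x (L x)" for x
    using tendsto_le[OF sequentially_bot bb[OF tendsto_const lim[of x]] tendsto_const, of 0] E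
    by (simp add: pos_contraction_nonneg)
  ultimately show ?thesis using scale norm by (simp add: pos_contraction_def bounded_clinear_def)
qed

lemma pos_contraction_funpow:
  assumes K: "pos_contraction K" shows "pos_contraction (K ^^ n)"
proof -
  have "0 \<le> rinner x ((K ^^ n) x)" for x
    using rinner_funpow_diff_nonneg[OF K, of x n 0] by simp
  moreover have "bounded_clinear (K ^^ n)"
  proof (induction n)
    case 0
    then show ?case by (simp add: bounded_clinear_def id_def bounded_linear_ident)
  next
    case (Suc n)
    then show ?case using pos_contraction_bounded_clinear[OF K]
      by (auto simp: bounded_clinear_def o_def intro: bounded_linear_compose)
  qed
  ultimately show ?thesis
    using norm_funpow_le[of K] rinner_funpow_symmetric[of K] K by (auto simp: pos_contraction_def)
qed

section \<open>The generated semigroup\<close>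

context nonneg_selfadjoint
begin

text \<open>Halving the step keeps the Euler products comparable factor by factor, hence the powers of two.\<close>
definition euler :: "real \<Rightarrow> nat \<Rightarrow> 'a \<Rightarrow> 'a"
  where "euler t k = G (t / 2 ^ k) ^^ (2 ^ k)"

definition T :: "real \<Rightarrow> 'a \<Rightarrow> 'a"
  where "T t x = lim (\<lambda>k. euler t k x)"

lemma euler_pos_contraction: "0 \<le> t \<Longrightarrow> pos_contraction (euler t k)"
  by (simp add: euler_def pos_contraction_funpow G_pos_contraction)

text \<open>These sets are invariant under all resolvents, which commute with \<open>A\<close>; they serve as the
  invariant sets for telescoping.\<close>
definition bounded_D2 :: "real \<Rightarrow> 'a set"
  where "bounded_D2 c = {y \<in> D2. norm (A (A y)) \<le> c}"

lemma G_bounded_D2: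
  assumes s: "0 \<le> s" and y: "y \<in> bounded_D2 c" shows "G s y \<in> bounded_D2 c"
proof -
  have "A (A (G s y)) = G s (A (A y))"
    using s y by (simp add: bounded_D2_def A_G D2_D D2_A)
  then show ?thesis
    using G_norm[OF s, of "A (A y)"] y s by (simp add: bounded_D2_def G_D2)
qed

lemma euler_step:
  assumes t: "0 \<le> t" and x: "x \<in> D2"
  shows "norm (euler t (Suc k) x - euler t k x) \<le> t\<^sup>2 / 4 * norm (A (A x)) * (1/2) ^ k"
proof -
  define h where "h = t / 2 ^ Suc k"
  have h: "0 \<le> h" "t / 2 ^ k = h + h" using t by (simp_all add: h_def field_simps)
  have eq: "euler t (Suc k) = (G h ^^ 2) ^^ (2 ^ k)"
    by (simp only: euler_def h_def funpow_mult power_Suc)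
  have "norm (((G h ^^ 2) ^^ (2 ^ k)) x - (G (h + h) ^^ (2 ^ k)) x)
      \<le> real (2 ^ k) * (h * h * norm (A (A x)))"
  proof (rule norm_funpow_diff_le[where V = "bounded_D2 (norm (A (A x)))"])
    show "linear (G h ^^ 2)" using h by (intro linear_funpow G_linear)
    show "norm ((G h ^^ 2) y) \<le> norm y" for y using h by (intro norm_funpow_le G_norm)
    show "G (h + h) y \<in> bounded_D2 (norm (A (A x)))" if "y \<in> bounded_D2 (norm (A (A x)))" for y
      using that h by (intro G_bounded_D2) auto
    show "norm ((G h ^^ 2) y - G (h + h) y) \<le> h * h * norm (A (A x))"
      if "y \<in> bounded_D2 (norm (A (A x)))" for y
    proof -
      have "norm (G h (G h y) - G (h + h) y) \<le> h * h * norm (A (A y))"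
        using that h by (intro G_semigroup_defect) (auto simp: bounded_D2_def)
      also have "\<dots> \<le> h * h * norm (A (A x))"
        using that by (intro mult_left_mono) (auto simp: bounded_D2_def)
      finally show ?thesis by (simp add: numeral_2_eq_2)
    qed
    show "x \<in> bounded_D2 (norm (A (A x)))" using x by (simp add: bounded_D2_def)
  qed
  also have "real (2 ^ k) * (h * h * norm (A (A x))) = t\<^sup>2 / 4 * norm (A (A x)) * (1/2) ^ k"
    by (simp add: h_def power2_eq_square field_simps)
  finally show ?thesis by (simp only: eq euler_def[of t k] h(2))
qed

lemma euler_tendsto:
  assumes t: "0 \<le> t" shows "(\<lambda>k. euler t k x) \<longlonglongrightarrow> T t x"
proof -
  have "convergent (\<lambda>k. euler t k x)"
  proof (rule contractions_convergent_dense[OF _ _ _ D2_dense])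
    show "convergent (\<lambda>k. euler t k y)" if "y \<in> D2" for y
      using geometric_steps_converge[OF euler_step[OF t that]] by (auto simp: convergent_def)
  qed (use euler_pos_contraction[OF t] in \<open>auto simp: pos_contraction_linear pos_contraction_norm\<close>)
  then show ?thesis by (simp add: T_def convergent_LIMSEQ_iff)
qed

lemma T_pos_contraction: "0 \<le> t \<Longrightarrow> pos_contraction (T t)"
  using pos_contraction_limit[of "euler t"] euler_pos_contraction euler_tendsto by blast

lemmas T_linear = pos_contraction_linear[OF T_pos_contraction]
  and T_norm = pos_contraction_norm[OF T_pos_contraction]

lemma T_0 [simp]: "T 0 x = x"
proof -
  have "euler 0 k x = x" for k
    by (simp add: euler_def G_def id_funpow)
  then have "(\<lambda>k. euler 0 k x) \<longlonglongrightarrow> x" by simp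
  then show ?thesis by (rule LIMSEQ_unique[OF euler_tendsto[OF order_refl]])
qed

text \<open>Both \<open>T t\<close> and the Taylor polynomial are compared with a single resolvent \<open>G t\<close>: the first
  distance is at most the total of the Euler steps, the second is \<open>t\<^sup>2 G t A\<^sup>2\<close>.\<close>
lemma T_taylor:
  assumes t: "0 \<le> t" and x: "x \<in> D2"
  shows "norm (T t x - x + t *\<^sub>R A x) \<le> 3 / 2 * t\<^sup>2 * norm (A (A x))"
proof -
  note lin = linear_add[OF G_linear[OF t]] linear_scale[OF G_linear[OF t]]
  obtain L where "(\<lambda>k. euler t k x) \<longlonglongrightarrow> L" "norm (L - euler t 0 x) \<le> 2 * (t\<^sup>2 / 4 * norm (A (A x)))"
    using geometric_steps_converge[OF euler_step[OF t x]] by blast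
  then have 1: "norm (T t x - G t x) \<le> t\<^sup>2 / 2 * norm (A (A x))"
    using LIMSEQ_unique[OF euler_tendsto[OF t, of x], of L] by (simp add: euler_def mult_ac)
  have "x = G t x + t *\<^sub>R G t (A x)" "A x = G t (A x) + t *\<^sub>R G t (A (A x))"
    using G_shift[OF t D2_D[OF x]] G_shift[OF t D2_A[OF x]] by (simp_all add: lin)
  then have "G t x - x + t *\<^sub>R A x
      = G t x - (G t x + t *\<^sub>R G t (A x)) + t *\<^sub>R (G t (A x) + t *\<^sub>R G t (A (A x)))"
    by metis
  then have "G t x - x + t *\<^sub>R A x = t\<^sup>2 *\<^sub>R G t (A (A x))"
    by (simp add: scaleR_add_right power2_eq_square)
  then have 2: "norm (G t x - x + t *\<^sub>R A x) \<le> t\<^sup>2 * norm (A (A x))"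
    using G_norm[OF t] by (simp add: mult_left_mono)
  show ?thesis
    using norm_triangle_ineq[of "T t x - G t x" "G t x - x + t *\<^sub>R A x"] 1 2 by (simp add: algebra_simps)
qed

lemma T_diff_le:
  assumes t: "0 \<le> t" and x: "x \<in> D"
  shows "norm (T t x - x) \<le> t * norm (A x)"
proof (rule LIMSEQ_le_const2[OF tendsto_norm[OF tendsto_diff[OF euler_tendsto[OF t] tendsto_const]]])
  have "norm (euler t k x - x) \<le> t * norm (A x)" for k
  proof -
    have s: "0 \<le> t / 2 ^ k" using t by simp
    have "norm (G (t / 2 ^ k) x - x) \<le> t / 2 ^ k * norm (A x)"
    proof -
      have "G (t / 2 ^ k) x - x = - ((t / 2 ^ k) *\<^sub>R G (t / 2 ^ k) (A x))"
        using G_shift[OF s x] by (simp add: linear_add[OF G_linear[OF s]] linear_scale[OF G_linear[OF s]] algebra_simps)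
      then show ?thesis using G_norm[OF s, of "A x"] s t by (simp add: divide_right_mono mult_left_mono)
    qed
    then have "norm ((G (t / 2 ^ k) ^^ (2 ^ k)) x - (id ^^ (2 ^ k)) x) \<le> real (2 ^ k) * (t / 2 ^ k * norm (A x))"
      by (intro norm_funpow_diff_le[where V = "{x}"] G_linear G_norm s) auto
    then show ?thesis by (simp add: euler_def)
  qed
  then show "\<exists>N. \<forall>k\<ge>N. norm (euler t k x - x) \<le> t * norm (A x)"
    by blast
qed

lemma funpow_compose_commuting:
  assumes "\<And>x. f (g x) = g (f x)"
  shows "((\<lambda>x. f (g x)) ^^ n) x = (f ^^ n) ((g ^^ n) x)"
proof (induction n)
  case (Suc n)
  have "(f ^^ n) (g y) = g ((f ^^ n) y)" for y by (rule funpow_commute) (rule assms)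
  then show ?case by (simp add: Suc)
qed simp

lemma T_add:
  assumes s: "0 \<le> s" and t: "0 \<le> t" shows "T (s + t) x = T s (T t x)"
proof (rule continuous_eq_on_dense[OF D2_dense, where f = "T (s + t)" and g = "\<lambda>x. T s (T t x)"])
  show "continuous_on UNIV (T (s + t))" using s t by (intro pos_contraction_continuous T_pos_contraction) simp
  show "continuous_on UNIV (\<lambda>x. T s (T t x))"
    using continuous_on_compose2[of UNIV "T s" UNIV "T t"] s t
    by (simp add: pos_contraction_continuous T_pos_contraction)
  fix y assume y: "y \<in> D2"
  have bound: "norm (euler s k (euler t k y) - euler (s + t) k y) \<le> s * t * norm (A (A y)) * (1/2) ^ k" for k
  proof -
    define a b where "a = s / 2 ^ k" and "b = t / 2 ^ k"
    have ab: "0 \<le> a" "0 \<le> b" "(s + t) / 2 ^ k = a + b"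
      using s t by (simp_all add: a_def b_def add_divide_distrib)
    have "norm (((\<lambda>x. G a (G b x)) ^^ (2 ^ k)) y - (G (a + b) ^^ (2 ^ k)) y)
        \<le> real (2 ^ k) * (a * b * norm (A (A y)))"
    proof (rule norm_funpow_diff_le[where V = "bounded_D2 (norm (A (A y)))"])
      show "linear (\<lambda>x. G a (G b x))"
        using linear_compose[OF G_linear[OF ab(2)] G_linear[OF ab(1)]] by (simp add: o_def)
      show "norm (G a (G b x)) \<le> norm x" for x by (rule order_trans[OF G_norm[OF ab(1)] G_norm[OF ab(2)]])
      show "G (a + b) x \<in> bounded_D2 (norm (A (A y)))" if "x \<in> bounded_D2 (norm (A (A y)))" for x
        using that ab by (intro G_bounded_D2) auto
      show "norm (G a (G b x) - G (a + b) x) \<le> a * b * norm (A (A y))"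
        if "x \<in> bounded_D2 (norm (A (A y)))" for x
      proof -
        have "norm (G a (G b x) - G (a + b) x) \<le> a * b * norm (A (A x))"
          using that ab by (intro G_semigroup_defect) (auto simp: bounded_D2_def)
        also have "\<dots> \<le> a * b * norm (A (A y))"
          using that ab by (intro mult_left_mono) (auto simp: bounded_D2_def)
        finally show ?thesis .
      qed
      show "y \<in> bounded_D2 (norm (A (A y)))" using y by (simp add: bounded_D2_def)
    qed
    moreover have "((\<lambda>x. G a (G b x)) ^^ (2 ^ k)) y = euler s k (euler t k y)"
      using funpow_compose_commuting[of "G a" "G b"] G_commute[OF ab(1,2)]
      by (simp add: euler_def a_def b_def)
    moreover have "real (2 ^ k) * (a * b * norm (A (A y))) = s * t * norm (A (A y)) * (1/2) ^ k"
      by (simp add: a_def b_def field_simps)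
    ultimately show ?thesis by (simp only: euler_def[of "s + t"] ab(3))
  qed
  have half: "(\<lambda>k. s * t * norm (A (A y)) * (1/2) ^ k) \<longlonglongrightarrow> 0"
    by (intro tendsto_mult_right_zero LIMSEQ_power_zero) simp
  have "(\<lambda>k. euler s k (euler t k y) - euler (s + t) k y) \<longlonglongrightarrow> 0"
    by (rule Lim_null_comparison[OF _ half]) (simp add: bound)
  from tendsto_add[OF this euler_tendsto[of "s + t" y]] s t
  have 1: "(\<lambda>k. euler s k (euler t k y)) \<longlonglongrightarrow> T (s + t) y" by simp
  have "(\<lambda>k. euler s k (euler t k y - T t y)) \<longlonglongrightarrow> 0"
    by (rule Lim_null_comparison[OF _ tendsto_norm_zero[OF LIM_zero[OF euler_tendsto[OF t, of y]]]])
       (simp add: pos_contraction_norm[OF euler_pos_contraction[OF s]])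
  from tendsto_add[OF this euler_tendsto[OF s, of "T t y"]]
  have "(\<lambda>k. euler s k (euler t k y)) \<longlonglongrightarrow> T s (T t y)"
    by (simp add: linear_diff[OF pos_contraction_linear[OF euler_pos_contraction[OF s]]])
  then show "T (s + t) y = T s (T t y)" using LIMSEQ_unique[OF 1] by blast
qed

lemma T_funpow: "0 \<le> s \<Longrightarrow> (T s ^^ n) x = T (real n * s) x"
  by (induction n) (simp_all add: T_add algebra_simps)

lemma T_G:
  assumes t: "0 \<le> t" and s: "0 \<le> s" shows "T t (G s x) = G s (T t x)"
proof -
  have "euler t k (G s x) = G s (euler t k x)" for k
    unfolding euler_def using t s by (intro funpow_commute G_commute) auto
  then show ?thesis
    using LIMSEQ_unique[OF euler_tendsto[OF t, of "G s x"]]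
      bounded_linear.tendsto[OF pos_contraction_bounded_linear[OF G_pos_contraction[OF s]] euler_tendsto[OF t, of x]]
    by simp
qed

lemma T_tendsto_0: "((\<lambda>t. T t x) \<longlongrightarrow> x) (at_right 0)"
proof (rule tendstoI)
  fix e :: real assume e: "0 < e"
  obtain y where y: "y \<in> D" "dist y x < e / 3"
    using closure_approachable[of x D] dense e by (metis UNIV_I divide_pos_pos zero_less_numeral)
  have "((\<lambda>t. t * norm (A y)) \<longlongrightarrow> 0 * norm (A y)) (at_right 0)"
    by (intro tendsto_intros)
  then have "\<forall>\<^sub>F t in at_right 0. t * norm (A y) < e / 3"
    using e by (intro order_tendstoD(2)[where y = "0 * norm (A y)"]) auto
  then show "\<forall>\<^sub>F t in at_right 0. dist (T t x) x < e"
    using eventually_at_right_less[of 0]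
  proof eventually_elim
    case (elim t)
    then have t: "0 \<le> t" by simp
    have "dist (T t x) (T t y) \<le> dist x y"
      using T_norm[OF t, of "x - y"] by (simp add: dist_norm linear_diff[OF T_linear[OF t]])
    moreover have "dist (T t y) y < e / 3"
      using T_diff_le[OF t y(1)] elim by (simp add: dist_norm)
    ultimately show ?case
      using y(2) dist_triangle[of "T t x" x "T t y"] dist_triangle[of "T t y" x y] dist_commute[of x y]
      by linarith
  qed
qed

lemma C0_semigroup_T: "C0_semigroup T"
  using T_add T_tendsto_0 pos_contraction_bounded_clinear[OF T_pos_contraction]
  by (auto simp: C0_semigroup_def fun_eq_iff)

lemma T_right_derivative:
  assumes x: "x \<in> D"
  shows "((\<lambda>h. (T h x - x) /\<^sub>R h) \<longlongrightarrow> - A x) (at_right 0)"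
proof (rule tendstoI)
  fix e :: real assume e: "0 < e"
  obtain y where y: "y \<in> D2" "norm (A x - A y) < e / 3"
    using D2_core[OF x, of "e / 3"] e by auto
  have yD: "y \<in> D" using D2_D[OF y(1)] .
  have "((\<lambda>t. t * (3 / 2 * norm (A (A y)))) \<longlongrightarrow> 0 * (3 / 2 * norm (A (A y)))) (at_right 0)"
    by (intro tendsto_intros)
  then have "\<forall>\<^sub>F t in at_right 0. t * (3 / 2 * norm (A (A y))) < e / 3"
    using e by (intro order_tendstoD(2)[where y = "0 * (3 / 2 * norm (A (A y)))"]) auto
  then show "\<forall>\<^sub>F h in at_right 0. dist ((T h x - x) /\<^sub>R h) (- A x) < e"
    using eventually_at_right_less[of 0]
  proof eventually_elim
    case (elim h)
    then have h: "0 \<le> h" "0 < h" by auto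
    have quot: "norm (v /\<^sub>R h) \<le> c" if "norm v \<le> h * c" for v :: 'a and c
      using that h by (simp add: field_simps)
    have 1: "norm ((T h (x - y) - (x - y)) /\<^sub>R h) \<le> norm (A x - A y)"
      using T_diff_le[OF h(1) D_diff[OF x yD]] by (intro quot) (simp add: A_diff x yD)
    have 2: "norm ((T h y - y + h *\<^sub>R A y) /\<^sub>R h) \<le> h * (3 / 2 * norm (A (A y)))"
      using T_taylor[OF h(1) y(1)] by (intro quot) (simp add: power2_eq_square algebra_simps)
    have "(T h x - x) /\<^sub>R h + A x = (T h (x - y) - (x - y)) /\<^sub>R h + ((T h y - y + h *\<^sub>R A y) /\<^sub>R h + (A x - A y))"
      using h by (simp add: linear_diff[OF T_linear] algebra_simps)
    then have "norm ((T h x - x) /\<^sub>R h + A x) \<le> norm (A x - A y) + (h * (3 / 2 * norm (A (A y))) + norm (A x - A y))"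
      using 1 2 by (metis norm_triangle_mono order_refl)
    then show ?case using elim y(2) by (simp add: dist_norm)
  qed
qed

text \<open>The generator extends \<open>- A\<close>. It cannot be larger: if \<open>x\<close> has a derivative \<open>y\<close> at \<open>0\<close>, choose
  \<open>z\<close> in \<open>D\<close> with \<open>(1 + A) z = x - y\<close>. Then \<open>v = x - z\<close> has derivative \<open>v\<close>, which is
  impossible for a contraction semigroup unless \<open>v = 0\<close>.\<close>
lemma has_generator_T: "has_generator T D (\<lambda>x. - A x)"
proof -
  have "x \<in> D" if lim: "((\<lambda>h. (T h x - x) /\<^sub>R h) \<longlongrightarrow> y) (at_right 0)" for x y
  proof -
    obtain z where z: "z \<in> D" "z + A z = x - y" using one_plus_onto by blast
    define v where "v = x - z"
    have "((\<lambda>h. (T h x - x) /\<^sub>R h - (T h z - z) /\<^sub>R h) \<longlongrightarrow> y - - A z) (at_right 0)"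
      by (intro tendsto_diff lim T_right_derivative z)
    moreover have "\<forall>\<^sub>F h in at_right 0. (T h x - x) /\<^sub>R h - (T h z - z) /\<^sub>R h = (T h v - v) /\<^sub>R h"
      using eventually_at_right_less[of 0]
      by eventually_elim (simp add: v_def linear_diff[OF T_linear] algebra_simps)
    moreover have "y - - A z = v" using z(2) by (simp add: v_def algebra_simps)
    ultimately have "((\<lambda>h. (T h v - v) /\<^sub>R h) \<longlongrightarrow> v) (at_right 0)"
      using Lim_transform_eventually by fastforce
    then have "((\<lambda>h. rinner v ((T h v - v) /\<^sub>R h)) \<longlongrightarrow> rinner v v) (at_right 0)"
      by (intro bounded_bilinear.tendsto[OF bounded_bilinear_rinner] tendsto_const)
    moreover have "\<forall>\<^sub>F h in at_right 0. rinner v ((T h v - v) /\<^sub>R h) \<le> 0"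
      using eventually_at_right_less[of 0]
    proof eventually_elim
      case (elim h)
      have "rinner v (T h v) \<le> norm v * norm v"
        using rinner_le_norm[of v "T h v"] mult_left_mono[OF T_norm[of h v] norm_ge_zero[of v]] elim
        by simp
      then show ?case using elim
        by (simp add: rinner_simps rinner_self power2_eq_square mult_nonneg_nonpos)
    qed
    ultimately have "rinner v v \<le> 0"
      using tendsto_upperbound trivial_limit_at_right_real by blast
    then have "v = 0" by (simp add: rinner_self)
    then show ?thesis using z(1) by (simp add: v_def)
  qed
  then show ?thesis using T_right_derivative unfolding has_generator_def by blast
qed

text \<open>Smoothing by the semigroup. With \<open>h = s / (k + 1)\<close>, the operator \<open>T s\<close> is the power
  \<open>k + 1\<close> of \<open>T h\<close>, so \<open>pos_contraction_funpow_diff_le\<close> bounds the difference quotient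
  \<open>T s (T h x - x) / h\<close> by \<open>\<parallel>x\<parallel> / s\<close> uniformly in \<open>k\<close>.\<close>
lemma T_A_norm_le:
  assumes s: "0 < s" and x: "x \<in> D"
  shows "norm (T s (A x)) \<le> norm x / s"
proof -
  have seq: "filterlim (\<lambda>k. s / real (Suc k)) (at_right 0) sequentially"
    unfolding filterlim_at using s LIMSEQ_Suc[OF lim_const_over_n[of s]] by auto
  have "(\<lambda>k. T s ((T (s / real (Suc k)) x - x) /\<^sub>R (s / real (Suc k)))) \<longlonglongrightarrow> T s (- A x)"
    using filterlim_compose[OF T_right_derivative[OF x] seq] s
    by (intro bounded_linear.tendsto[OF pos_contraction_bounded_linear[OF T_pos_contraction]]) auto
  then have lim: "(\<lambda>k. norm (T s ((T (s / real (Suc k)) x - x) /\<^sub>R (s / real (Suc k))))) \<longlonglongrightarrow> norm (T s (- A x))"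
    by (rule tendsto_norm)
  have "norm (T s ((T (s / real (Suc k)) x - x) /\<^sub>R (s / real (Suc k)))) \<le> norm x / s" for k
  proof -
    define h where "h = s / real (Suc k)"
    have h: "0 < h" "real (Suc k) * h = s" using s by (auto simp: h_def)
    have "T s y = (T h ^^ Suc k) y" for y using T_funpow[of h "Suc k" y] h by simp
    then have "norm (T s (x - T h x)) \<le> norm x / (real (Suc k) + 1)"
      using pos_contraction_funpow_diff_le[OF T_pos_contraction[of h], of "Suc k" x] h by simp
    also have "\<dots> \<le> norm x / real (Suc k)" by (intro divide_left_mono) auto
    finally have "norm (T s (x - T h x)) / h \<le> norm x / real (Suc k) / h"
      by (rule divide_right_mono) (use h in simp)
    moreover have "norm (T s ((T h x - x) /\<^sub>R h)) = norm (T s (x - T h x)) / h"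
      using h s by (simp add: linear_scale[OF T_linear] linear_diff[OF T_linear] norm_minus_commute divide_inverse mult.commute)
    moreover have "norm x / real (Suc k) / h = norm x / s"
      unfolding h(2)[symmetric] by (simp only: divide_divide_eq_left)
    ultimately show ?thesis unfolding h_def[symmetric] by (simp only:)
  qed
  then have "norm (T s (- A x)) \<le> norm x / s" by (intro LIMSEQ_le_const2[OF lim]) auto
  then show ?thesis using linear_neg[OF T_linear, of s "A x"] s by simp
qed

end

section \<open>Uniqueness of the semigroup with a given generator\<close>

text \<open>The Baire category theorem, applied to the closed sets on which all \<open>E k\<close> are bounded by \<open>m\<close>.\<close>
lemma bounded_linear_pointwise_bounded_on_ball:
  fixes E :: "nat \<Rightarrow> 'a::banach \<Rightarrow> 'b::real_normed_vector"
  assumes E: "\<And>k. bounded_linear (E k)" and bdd: "\<And>x. \<exists>c. \<forall>k. norm (E k x) \<le> c"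
  shows "\<exists>m::nat. \<exists>x0. \<exists>r>0. \<forall>x\<in>ball x0 r. \<forall>k. norm (E k x) \<le> real m"
proof (rule ccontr)
  assume neg: "\<not> ?thesis"
  define B where "B m = {x. \<forall>k. norm (E k x) \<le> real m}" for m :: nat
  have "closed (B m)" for m
  proof -
    have "closed {x. norm (E k x) \<le> real m}" for k
      by (intro closed_Collect_le continuous_on_norm linear_continuous_on E continuous_on_const)
    moreover have "B m = (\<Inter>k. {x. norm (E k x) \<le> real m})" by (auto simp: B_def)
    ultimately show ?thesis by (simp add: closed_INT)
  qed
  moreover have "interior (B m) = {}" for m
  proof (rule ccontr)
    assume "interior (B m) \<noteq> {}"
    then obtain x0 r where "0 < r" "ball x0 r \<subseteq> B m"
      by (meson all_not_in_conv mem_interior)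
    then have "\<forall>x\<in>ball x0 r. \<forall>k. norm (E k x) \<le> real m"
      by (auto simp: B_def)
    then show False using neg \<open>0 < r\<close> by blast
  qed
  ultimately have "interior (\<Union>(range B)) = {}"
    using Met_TC.metric_Baire_category_alt[of "range B"] complete_UNIV
    by (auto simp: interior_of_def interior_def)
  moreover have "\<Union>(range B) = UNIV"
  proof -
    have "\<exists>m. x \<in> B m" for x
    proof -
      obtain c where c: "\<And>k. norm (E k x) \<le> c" using bdd by blast
      obtain m where m: "c \<le> real m" using real_arch_simple[of c] by blast
      have "x \<in> B m" using order_trans[OF c m] by (simp add: B_def)
      then show ?thesis ..
    qed
    then show ?thesis by auto
  qed
  ultimately show False by simp
qed

theorem uniform_boundedness:
  fixes E :: "nat \<Rightarrow> 'a::banach \<Rightarrow> 'b::real_normed_vector"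
  assumes E: "\<And>k. bounded_linear (E k)" and bdd: "\<And>x. \<exists>c. \<forall>k. norm (E k x) \<le> c"
  shows "\<exists>c. \<forall>k x. norm (E k x) \<le> c * norm x"
proof -
  obtain m x0 r where r: "0 < r" and m: "\<And>x k. dist x0 x < r \<Longrightarrow> norm (E k x) \<le> real m"
    using bounded_linear_pointwise_bounded_on_ball[OF E bdd] by (metis mem_ball)
  have "norm (E k x) \<le> (4 * real m / r) * norm x" for k x
  proof (cases "x = 0")
    case True
    then show ?thesis using linear_0[OF bounded_linear.linear[OF E]] by simp
  next
    case False
    define s where "s = r / (2 * norm x)"
    have s: "0 < s" "s * norm x < r" using False r by (simp_all add: s_def)
    have lin: "E k (x0 + s *\<^sub>R x) - E k x0 = s *\<^sub>R E k x"
      by (simp add: linear_add linear_scale bounded_linear.linear[OF E])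
    have "norm (s *\<^sub>R E k x) \<le> norm (E k (x0 + s *\<^sub>R x)) + norm (E k x0)"
      unfolding lin[symmetric] by (rule norm_triangle_ineq4)
    also have "\<dots> \<le> real m + real m"
      using s r by (intro add_mono m) (auto simp: dist_norm)
    finally have "norm (E k x) \<le> 2 * real m / s" using s by (simp add: field_simps)
    then show ?thesis using False r by (simp add: s_def field_simps)
  qed
  then show ?thesis by blast
qed

text \<open>If the operators were unbounded along some \<open>s k \<longlonglongrightarrow> 0\<close>, strong continuity at \<open>0\<close> would contradict
  uniform boundedness. The semigroup law extends the bound from short times to all of
  \<open>[0, t]\<close>.\<close>
lemma C0_semigroup_locally_bounded:
  assumes T: "C0_semigroup T"
  shows "\<exists>c\<ge>0. \<forall>s\<in>{0..t}. \<forall>x. norm (T s x) \<le> c * norm x"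
proof -
  have lin: "bounded_linear (T s)" if "0 \<le> s" for s
    using T that by (simp add: C0_semigroup_def bounded_clinear_def)
  have add: "T (s + r) x = T s (T r x)" if "0 \<le> s" "0 \<le> r" for s r x
    using T that by (simp add: C0_semigroup_def)
  have zero: "T 0 x = x" for x using T by (simp add: C0_semigroup_def)
  have "\<exists>\<delta>>0. \<exists>c. \<forall>s\<in>{0<..<\<delta>}. \<forall>x. norm (T s x) \<le> c * norm x"
  proof (rule ccontr)
    assume neg: "\<not> ?thesis"
    have "\<exists>s\<in>{0<..<1 / real (Suc k)}. \<exists>x. norm (T s x) > real k * norm x" for k
    proof -
      have "0 < 1 / real (Suc k)" by simp
      then have "\<not> (\<forall>s\<in>{0<..<1 / real (Suc k)}. \<forall>x. norm (T s x) \<le> real k * norm x)"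
        using neg by blast
      then show ?thesis by (auto simp: not_le)
    qed
    then obtain s where s: "\<And>k. s k \<in> {0<..<1 / real (Suc k)}"
      and big: "\<And>k. \<exists>x. norm (T (s k) x) > real k * norm x"
      by metis
    have "s \<longlonglongrightarrow> 0"
      by (rule tendsto_sandwich[OF _ _ tendsto_const LIMSEQ_Suc[OF lim_const_over_n[of 1]]])
         (use s in \<open>auto intro!: always_eventually less_imp_le\<close>)
    moreover have "s k \<in> {0<..} \<and> s k \<noteq> 0" for k using s[of k] by simp
    ultimately have s0: "filterlim s (at_right 0) sequentially"
      unfolding filterlim_at by (intro conjI always_eventually allI) blast+
    have bl: "bounded_linear (T (s k))" for k using s[of k] lin by auto
    have "\<exists>c. \<forall>k. norm (T (s k) x) \<le> c" for x
    proof -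
      have "((\<lambda>t. T t x) \<longlongrightarrow> x) (at_right 0)" using T by (simp add: C0_semigroup_def)
      then have "(\<lambda>k. T (s k) x) \<longlonglongrightarrow> x" using s0 by (rule filterlim_compose)
      then have "Bseq (\<lambda>k. T (s k) x)" by (rule convergentI[THEN convergent_imp_Bseq])
      then show ?thesis by (auto simp: Bseq_def)
    qed
    then obtain c where c: "\<And>k x. norm (T (s k) x) \<le> c * norm x"
      using uniform_boundedness[of "\<lambda>k. T (s k)"] bl by blast
    obtain k where "c \<le> real k" using real_arch_simple by blast
    obtain x where "real k * norm x < norm (T (s k) x)" using big by blast
    also have "\<dots> \<le> real k * norm x" using c[of k x] mult_right_mono[OF \<open>c \<le> real k\<close>, of "norm x"] by simp
    finally show False by simp
  qed
  then obtain d c where d: "0 < d" and c: "\<And>s x. 0 < s \<Longrightarrow> s < d \<Longrightarrow> norm (T s x) \<le> c * norm x"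
    by (metis greaterThanLessThan_iff)
  \<comment> \<open>A constant at least \<open>1\<close> also covers the time \<open>0\<close>.\<close>
  define C where "C = max c 1"
  have C: "norm (T s x) \<le> C * norm x" if "0 \<le> s" "s < d" for s x
  proof (cases "s = 0")
    case True
    then show ?thesis using mult_right_mono[of 1 C "norm x"] by (simp add: zero C_def)
  next
    case False
    then show ?thesis using c[of s x] that mult_right_mono[of c C "norm x"] by (simp add: C_def)
  qed
  obtain n :: nat where n: "t / d < real n" using reals_Archimedean2 by blast
  have pow: "norm (T (real k * s) x) \<le> C ^ k * norm x" if "0 \<le> s" "s < d" for k s x
  proof (induction k)
    case (Suc k)
    have "T (real (Suc k) * s) x = T s (T (real k * s) x)"
      using add[of s "real k * s" x] that by (simp add: algebra_simps)
    also have "norm \<dots> \<le> C * norm (T (real k * s) x)" by (rule C[OF that])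
    also have "\<dots> \<le> C * (C ^ k * norm x)" using Suc by (intro mult_left_mono) (auto simp: C_def)
    finally show ?case by simp
  qed (simp add: zero)
  have "norm (T s x) \<le> C ^ Suc n * norm x" if "s \<in> {0..t}" for s x
  proof -
    have "s / real (Suc n) < d"
    proof -
      have "s \<le> t" using that by simp
      also have "t < real n * d" using n d by (simp add: field_simps)
      also have "\<dots> \<le> real (Suc n) * d" using d by simp
      finally show ?thesis by (simp add: field_simps)
    qed
    then show ?thesis using pow[of "s / real (Suc n)" "Suc n" x] that by simp
  qed
  then show ?thesis by (intro exI[of _ "C ^ Suc n"]) (auto simp: C_def)
qed

lemma
  assumes T: "C0_semigroup T" and gen: "has_generator T D B" and t: "0 \<le> t" and x: "x \<in> D"
  shows C0_semigroup_generator_domain: "T t x \<in> D"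
    and C0_semigroup_generator_commute: "B (T t x) = T t (B x)"
proof -
  have bl: "bounded_linear (T t)" using T t by (simp add: C0_semigroup_def bounded_clinear_def)
  have comm: "T h (T t x) = T t (T h x)" if "0 \<le> h" for h
  proof -
    have add: "T (r + s) y = T r (T s y)" if "0 \<le> r" "0 \<le> s" for r s y
      using T that by (simp add: C0_semigroup_def)
    show ?thesis using add[OF that t, of x] add[OF t that, of x] by (simp add: add.commute)
  qed
  have "((\<lambda>h. T t ((T h x - x) /\<^sub>R h)) \<longlongrightarrow> T t (B x)) (at_right 0)"
    using gen x by (intro bounded_linear.tendsto[OF bl]) (simp add: has_generator_def)
  moreover have "\<forall>\<^sub>F h in at_right 0. T t ((T h x - x) /\<^sub>R h) = (T h (T t x) - T t x) /\<^sub>R h"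
    using eventually_at_right_less[of 0]
    by eventually_elim (simp add: comm linear_scale linear_diff bounded_linear.linear[OF bl])
  ultimately have lim: "((\<lambda>h. (T h (T t x) - T t x) /\<^sub>R h) \<longlongrightarrow> T t (B x)) (at_right 0)"
    by (rule Lim_transform_eventually)
  then show D: "T t x \<in> D" using gen unfolding has_generator_def by blast
  show "B (T t x) = T t (B x)"
  proof (rule tendsto_unique[OF trivial_limit_at_right_real _ lim])
    show "((\<lambda>h. (T h (T t x) - T t x) /\<^sub>R h) \<longlongrightarrow> B (T t x)) (at_right 0)"
      using gen D by (simp add: has_generator_def)
  qed
qed

text \<open>The right derivative comes from the definition of the generator. For the left derivative the
  difference quotient at \<open>t - h\<close> is \<open>T (t - h)\<close> applied to the one at \<open>0\<close>, and it is here that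
  the local bound on \<open>T\<close> enters.\<close>
lemma C0_semigroup_orbit_derivative:
  assumes T: "C0_semigroup T" and gen: "has_generator T D B" and t: "0 < t" and x: "x \<in> D"
  shows "((\<lambda>s. T s x) has_vector_derivative T t (B x)) (at t)"
proof -
  have lin: "linear (T s)" if "0 \<le> s" for s
    using T that by (simp add: C0_semigroup_def bounded_clinear_def bounded_linear.linear)
  have add: "T (s + r) y = T s (T r y)" if "0 \<le> s" "0 \<le> r" for s r y
    using T that by (simp add: C0_semigroup_def)
  have lim: "((\<lambda>h. (T h y - y) /\<^sub>R h) \<longlongrightarrow> B y) (at_right 0)" if "y \<in> D" for y
    using gen that by (simp add: has_generator_def)
  obtain c where c: "0 \<le> c" "\<And>s x. 0 \<le> s \<Longrightarrow> s \<le> t \<Longrightarrow> norm (T s x) \<le> c * norm x"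
    using C0_semigroup_locally_bounded[OF T, of t] by auto
  have right: "((\<lambda>h. (T (t + h) x - T t x) /\<^sub>R h) \<longlongrightarrow> T t (B x)) (at_right 0)"
  proof -
    have "T t x \<in> D" "B (T t x) = T t (B x)"
      using C0_semigroup_generator_domain[OF T gen _ x] C0_semigroup_generator_commute[OF T gen _ x] t
      by simp_all
    then have "((\<lambda>h. (T h (T t x) - T t x) /\<^sub>R h) \<longlongrightarrow> T t (B x)) (at_right 0)"
      using lim by metis
    moreover have "\<forall>\<^sub>F h in at_right 0. (T h (T t x) - T t x) /\<^sub>R h = (T (t + h) x - T t x) /\<^sub>R h"
      using eventually_at_right_less[of 0]
      by eventually_elim (use add t in \<open>simp add: add.commute[of t]\<close>)
    ultimately show ?thesis by (rule Lim_transform_eventually)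
  qed
  have left: "((\<lambda>h. (T (t - h) x - T t x) /\<^sub>R (- h)) \<longlongrightarrow> T t (B x)) (at_right 0)"
  proof -
    let ?w = "\<lambda>h. (T h x - x) /\<^sub>R h"
    have "((\<lambda>h. c * norm (?w h - B x) + c * norm (B x - T h (B x))) \<longlongrightarrow> c * 0 + c * 0) (at_right 0)"
      using T unfolding C0_semigroup_def
      by (intro tendsto_intros tendsto_norm_zero LIM_zero lim x tendsto_eq_intros) auto
    then have bound0: "((\<lambda>h. c * norm (?w h - B x) + c * norm (B x - T h (B x))) \<longlongrightarrow> 0) (at_right 0)"
      by simp
    have "\<forall>\<^sub>F h in at_right 0. norm ((T (t - h) x - T t x) /\<^sub>R (- h) - T t (B x))
        \<le> c * norm (?w h - B x) + c * norm (B x - T h (B x))"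
      using eventually_at_right_less[of 0] eventually_at_right_real[OF t]
    proof eventually_elim
      case (elim h)
      then have h: "0 \<le> h" "0 \<le> t - h" "t - h \<le> t" "h \<noteq> 0" by auto
      have split: "T t y = T (t - h) (T h y)" for y using add[OF h(2,1), of y] by simp
      have "(T (t - h) x - T t x) /\<^sub>R (- h) - T t (B x) = T (t - h) (?w h - B x) + T (t - h) (B x - T h (B x))"
        unfolding split[of x] split[of "B x"] using h
        by (simp add: linear_diff[OF lin] linear_add[OF lin] linear_scale[OF lin] algebra_simps)
      then show ?case
        using norm_triangle_mono[OF c(2)[OF h(2,3), of "?w h - B x"] c(2)[OF h(2,3), of "B x - T h (B x)"]]
        by simp
    qed
    from LIM_zero_cancel[OF Lim_null_comparison[OF this bound0]] show ?thesis .
  qed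
  let ?q = "\<lambda>s. (T s x - T t x) /\<^sub>R (s - t)"
  have "(?q \<longlongrightarrow> T t (B x)) (at_left t)"
    unfolding filterlim_at_left_to_right filterlim_at_right_to_0[of _ _ "- t"] using left by simp
  moreover have "(?q \<longlongrightarrow> T t (B x)) (at_right t)"
    unfolding filterlim_at_right_to_0[of _ _ t] using right by (simp add: add.commute)
  ultimately have "(?q \<longlongrightarrow> T t (B x)) (at t)" by (simp add: filterlim_split_at)
  then have "((\<lambda>s. norm (?q s - T t (B x))) \<longlongrightarrow> 0) (at t)"
    by (intro tendsto_norm_zero LIM_zero)
  moreover have "\<forall>\<^sub>F s in at t. norm (?q s - T t (B x)) = norm (T s x - T t x - (s - t) *\<^sub>R T t (B x)) / norm (s - t)"
  proof (rule eventually_at_filter[THEN iffD2], rule always_eventually, intro allI impI)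
    fix s assume "s \<noteq> t"
    then have "?q s - T t (B x) = (T s x - T t x - (s - t) *\<^sub>R T t (B x)) /\<^sub>R (s - t)"
      by (simp add: scaleR_diff_right)
    then show "norm (?q s - T t (B x)) = norm (T s x - T t x - (s - t) *\<^sub>R T t (B x)) / norm (s - t)"
      by (simp add: divide_inverse mult.commute)
  qed
  ultimately have "((\<lambda>s. norm (T s x - T t x - (s - t) *\<^sub>R T t (B x)) / norm (s - t)) \<longlongrightarrow> 0) (at t)"
    by (rule Lim_transform_eventually)
  then show ?thesis
    by (simp add: has_vector_derivative_def has_derivative_iff_norm bounded_linear_scaleR_left)
qed

context nonneg_selfadjoint
begin

text \<open>For an initial value in \<open>D\<close>, the difference \<open>v\<close> of the two orbits solves \<open>v' = - A v\<close> with
  \<open>v 0 = 0\<close>. Since \<open>A\<close> is non-negative, \<open>\<parallel>v\<parallel>\<^sup>2\<close> does not increase, so \<open>v\<close> vanishes.\<close>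
lemma C0_semigroup_unique:
  assumes U: "C0_semigroup U" "has_generator U D (\<lambda>x. - A x)"
    and V: "C0_semigroup V" "has_generator V D (\<lambda>x. - A x)"
    and t: "0 \<le> t"
  shows "U t = V t"
proof
  fix x
  show "U t x = V t x"
  proof (rule continuous_eq_on_dense[OF dense, where f = "U t" and g = "V t"])
    show "continuous_on UNIV (U t)" "continuous_on UNIV (V t)"
      using U(1) V(1) t by (auto simp: C0_semigroup_def bounded_clinear_def intro: linear_continuous_on)
    fix y assume y: "y \<in> D"
    define v where "v s = U s y - V s y" for s
    let ?f = "\<lambda>s. rinner (v s) (v s)"
    have v0: "v 0 = 0" using U(1) V(1) by (simp add: v_def C0_semigroup_def)
    have dv: "(v has_vector_derivative - A (v s)) (at s)" if s: "0 < s" for s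
    proof -
      have D: "U s y \<in> D" "V s y \<in> D"
        using C0_semigroup_generator_domain[OF U less_imp_le[OF s] y]
          C0_semigroup_generator_domain[OF V less_imp_le[OF s] y] .
      have "(v has_vector_derivative U s (- A y) - V s (- A y)) (at s)"
        unfolding v_def[abs_def]
        by (intro has_vector_derivative_diff C0_semigroup_orbit_derivative[OF U s y]
            C0_semigroup_orbit_derivative[OF V s y])
      moreover have "U s (- A y) - V s (- A y) = - A (v s)"
        by (simp add: v_def A_diff[OF D] C0_semigroup_generator_commute[OF U less_imp_le[OF s] y, symmetric]
            C0_semigroup_generator_commute[OF V less_imp_le[OF s] y, symmetric])
      ultimately show ?thesis by simp
    qed
    have vD: "v s \<in> D" if "0 < s" for s
      using C0_semigroup_generator_domain[OF U less_imp_le[OF that] y]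
        C0_semigroup_generator_domain[OF V less_imp_le[OF that] y] by (simp add: v_def D_diff)
    have df: "(?f has_real_derivative (- 2 * rinner (v s) (A (v s)))) (at s)" if s: "0 < s" for s
      using bounded_bilinear.has_vector_derivative[OF bounded_bilinear_rinner dv[OF s] dv[OF s]]
      by (simp add: has_real_derivative_iff_has_vector_derivative rinner_simps rinner_commute[of "A (v s)" "v s"])
    have "?f t \<le> ?f 0"
    proof (cases "t = 0")
      case False
      then have t: "0 < t" using assms(5) by simp
      have cont: "(?f \<longlongrightarrow> ?f s) (at s)" if "0 < s" for s
        using DERIV_isCont[OF df[OF that]] by (simp add: isCont_def)
      have v_lim: "(v \<longlongrightarrow> v 0) (at_right 0)"
      proof -
        have "((\<lambda>s. U s y - V s y) \<longlongrightarrow> y - y) (at_right 0)"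
          using U(1) V(1) by (intro tendsto_diff) (simp_all add: C0_semigroup_def)
        then show ?thesis unfolding v0 by (simp add: v_def[abs_def])
      qed
      have "continuous_on {0..t} ?f"
      proof (rule continuous_on_IccI)
        show "(?f \<longlongrightarrow> ?f 0) (at_right 0)"
          by (intro bounded_bilinear.tendsto[OF bounded_bilinear_rinner] v_lim)
        show "(?f \<longlongrightarrow> ?f t) (at_left t)"
          using cont[OF t] by (rule tendsto_within_subset) simp
        show "(?f \<longlongrightarrow> ?f s) (at s)" if "0 < s" "s < t" for s
          using cont[OF that(1)] .
      qed (rule t)
      moreover have "\<exists>d. DERIV ?f s :> d \<and> d \<le> 0" if "0 < s" for s
        using df[OF that] nonneg[OF vD[OF that]] by (intro exI[of _ "- 2 * rinner (v s) (A (v s))"]) simp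
      ultimately show ?thesis
        by (intro DERIV_nonpos_imp_decreasing_open[of 0 t ?f, OF less_imp_le[OF t]])
    qed simp
    then have "v t = 0" by (simp add: v0 rinner_self)
    then show "U t y = V t y" by (simp add: v_def)
  qed
qed

lemma semigroup_exp_eq_T:
  assumes t: "0 \<le> t" shows "semigroup_exp D (\<lambda>x. - A x) t = T t"
  unfolding semigroup_exp_def
proof (rule the_equality)
  show "\<exists>V. C0_semigroup V \<and> has_generator V D (\<lambda>x. - A x) \<and> T t = V t"
    by (intro exI[of _ T] conjI C0_semigroup_T has_generator_T refl)
  show "U = T t" if "\<exists>V. C0_semigroup V \<and> has_generator V D (\<lambda>x. - A x) \<and> U = V t" for U
  proof -
    from that obtain V where V: "C0_semigroup V" "has_generator V D (\<lambda>x. - A x)" "U = V t" by blast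
    show ?thesis unfolding V(3) by (rule C0_semigroup_unique[OF V(1,2) C0_semigroup_T has_generator_T t])
  qed
qed

end

section \<open>Comparing powers with the semigroup\<close>

text \<open>Because \<open>P\<close> commutes with \<open>F\<close> and \<open>Q\<close> with \<open>\<Theta>\<close>, the one-step bound telescopes to
  \<open>P Z Q\<^sup>2 = O(n e)\<close>. Replacing \<open>P\<close> by \<open>Q\<close> or conversely costs \<open>\<delta>\<close>, which makes it possible
  to move the left weight to the right: \<open>P Z - Z Q = F\<^sup>n (P - Q) - (P - Q) \<Theta>\<^sup>n\<close>. So a weight
  on one side suffices, and either resolvent may be used for it.\<close>
lemma weighted_power_comparison:
  fixes F \<Theta> P Q :: "'a::real_normed_vector \<Rightarrow> 'a"
  assumes lin: "linear F" "linear \<Theta>" "linear P" "linear Q"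
    and contr: "\<And>x. norm (F x) \<le> norm x" "\<And>x. norm (\<Theta> x) \<le> norm x"
      "\<And>x. norm (P x) \<le> norm x" "\<And>x. norm (Q x) \<le> norm x"
    and comm: "\<And>x. P (F x) = F (P x)" "\<And>x. Q (\<Theta> x) = \<Theta> (Q x)"
    and PQ: "\<And>x. norm (P x - Q x) \<le> \<delta> * norm x"
    and step: "\<And>x. norm (P (F (Q (Q x)) - \<Theta> (Q (Q x)))) \<le> e * norm x"
    and nonneg: "0 \<le> \<delta>" "0 \<le> e"
    and Z: "\<And>x. Z x = (F ^^ n) x - (\<Theta> ^^ n) x"
  shows "norm (Z (Q (Q (Q x)))) \<le> (real n * e + 2 * \<delta>) * norm x"
    and "norm (Z (P (P (P x)))) \<le> (real n * e + 8 * \<delta>) * norm x"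
proof -
  have normF: "norm ((F ^^ k) x) \<le> norm x" and norm\<Theta>: "norm ((\<Theta> ^^ k) x) \<le> norm x" for k x
    by (intro norm_funpow_le contr)+
  have linF: "linear (F ^^ k)" and lin\<Theta>: "linear (\<Theta> ^^ k)" for k by (intro linear_funpow lin)+
  have commF: "P ((F ^^ k) x) = (F ^^ k) (P x)" and comm\<Theta>: "Q ((\<Theta> ^^ k) x) = (\<Theta> ^^ k) (Q x)" for k x
    using funpow_commute[of F P k x] funpow_commute[of \<Theta> Q k x] comm by simp_all
  have PQ_le: "norm (P y - Q y) \<le> \<delta> * norm x" if "norm y \<le> norm x" for x y
    using order_trans[OF PQ mult_left_mono[OF that nonneg(1)]] .
  have linZ: "Z (x + y) = Z x + Z y" "Z (x - y) = Z x - Z y" for x y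
    by (simp_all add: Z linear_add linear_diff linF lin\<Theta>)
  have normZ: "norm (Z x) \<le> 2 * norm x" for x
    using norm_triangle_ineq4[of "(F ^^ n) x" "(\<Theta> ^^ n) x"] normF[of n x] norm\<Theta>[of n x] by (simp add: Z)
  have tele: "norm (P ((F ^^ k) (Q (Q x)) - (\<Theta> ^^ k) (Q (Q x)))) \<le> real k * e * norm x" for k x
  proof (induction k arbitrary: x)
    case 0
    then show ?case by (simp add: linear_0 lin)
  next
    case (Suc k)
    have "P ((F ^^ Suc k) (Q (Q x)) - (\<Theta> ^^ Suc k) (Q (Q x)))
        = (F ^^ k) (P (F (Q (Q x)) - \<Theta> (Q (Q x))))
          + P ((F ^^ k) (Q (Q (\<Theta> x))) - (\<Theta> ^^ k) (Q (Q (\<Theta> x))))"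
      by (simp add: linear_diff linF lin commF comm funpow_swap1)
    also have "norm \<dots> \<le> e * norm x + real k * e * norm (\<Theta> x)"
      by (intro norm_triangle_mono order_trans[OF normF step] Suc.IH)
    also have "\<dots> \<le> e * norm x + real k * e * norm x"
      using contr(2)[of x] nonneg(2) by (intro add_left_mono mult_left_mono) auto
    finally show ?case by (simp add: algebra_simps)
  qed
  show ZQ: "norm (Z (Q (Q (Q x)))) \<le> (real n * e + 2 * \<delta>) * norm x" for x
  proof -
    let ?w = "Q (Q x)"
    have w: "norm ?w \<le> norm x" using order_trans[OF contr(4) contr(4)] .
    have "Z (Q ?w) = P (Z ?w) - (F ^^ n) (P ?w - Q ?w) + (P ((\<Theta> ^^ n) ?w) - Q ((\<Theta> ^^ n) ?w))"
      by (simp add: Z linear_diff linF lin commF comm\<Theta>)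
    also have "norm \<dots> \<le> (real n * e * norm x + \<delta> * norm x) + \<delta> * norm x"
    proof (rule norm_triangle_mono[OF order_trans[OF norm_triangle_ineq4 add_mono]])
      show "norm (P (Z ?w)) \<le> real n * e * norm x" unfolding Z by (rule tele)
      show "norm ((F ^^ n) (P ?w - Q ?w)) \<le> \<delta> * norm x"
        by (rule order_trans[OF normF PQ_le[OF w]])
      show "norm (P ((\<Theta> ^^ n) ?w) - Q ((\<Theta> ^^ n) ?w)) \<le> \<delta> * norm x"
        by (rule PQ_le[OF order_trans[OF norm\<Theta> w]])
    qed
    finally show ?thesis by (simp add: algebra_simps)
  qed
  show "norm (Z (P (P (P x)))) \<le> (real n * e + 8 * \<delta>) * norm x"
  proof -
    have "P (P (P x)) - Q (Q (Q x)) = (P (P (P x)) - Q (P (P x))) + (Q (P (P x) - Q (P x)) + Q (Q (P x - Q x)))"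
      by (simp add: linear_diff lin)
    also have "norm \<dots> \<le> \<delta> * norm x + (\<delta> * norm x + \<delta> * norm x)"
      by (rule norm_triangle_mono[OF PQ_le[OF order_trans[OF contr(3) contr(3)]]
            norm_triangle_mono[OF order_trans[OF contr(4) PQ_le[OF contr(3)]]
              order_trans[OF contr(4) order_trans[OF contr(4) PQ_le[OF order_refl]]]]])
    finally have diff: "norm (P (P (P x)) - Q (Q (Q x))) \<le> 3 * \<delta> * norm x" by simp
    have "Z (P (P (P x))) = Z (Q (Q (Q x))) + Z (P (P (P x)) - Q (Q (Q x)))"
      by (simp flip: linZ)
    also have "norm \<dots> \<le> (real n * e + 2 * \<delta>) * norm x + 2 * (3 * \<delta> * norm x)"
      by (rule norm_triangle_mono[OF ZQ order_trans[OF normZ mult_left_mono[OF diff]]]) simp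
    finally show ?thesis by (simp add: algebra_simps)
  qed
qed

text \<open>The estimate \<open>\<parallel>X w\<parallel> \<le> C \<parallel>P w\<parallel>\<close> says that \<open>X P\<^sup>-\<^sup>1\<close> is bounded, without mentioning the
  unbounded inverse.\<close>
lemma iterate_smoothing:
  fixes X P :: "'a::real_normed_vector \<Rightarrow> 'a"
  assumes smooth: "\<And>w. norm (X w) \<le> C * norm (P w)" and C: "0 \<le> C"
    and comm: "\<And>w. P (X w) = X (P w)"
  shows "norm (X (X (X w))) \<le> C ^ 3 * norm (P (P (P w)))"
proof -
  have "norm (X (X (X w))) \<le> C * norm (X (X (P w)))"
    using smooth[of "X (X w)"] by (simp add: comm)
  also have "\<dots> \<le> C * (C * norm (X (P (P w))))"
    using smooth[of "X (P w)"] C by (intro mult_left_mono) (simp_all add: comm)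
  also have "\<dots> \<le> C * (C * (C * norm (P (P (P w)))))"
    using smooth C by (intro mult_left_mono) auto
  finally show ?thesis by (simp add: power3_eq_cube)
qed

context nonneg_selfadjoint
begin

text \<open>Write \<open>w = G t w + t A (G t w)\<close> and absorb the unbounded part by \<open>T_A_norm_le\<close>.\<close>
lemma T_smoothing:
  assumes s: "0 < s" and t: "0 < t"
  shows "norm (T s w) \<le> (1 + t / s) * norm (G t w)"
proof -
  have "norm (T s w) = norm (T s (G t w) + t *\<^sub>R T s (A (G t w)))"
    using arg_cong[OF G_eq[OF t, of w], of "T s"] s
    by (simp add: linear_add[OF T_linear] linear_scale[OF T_linear])
  also have "\<dots> \<le> norm (G t w) + t * (norm (G t w) / s)"
    using T_norm[of s "G t w"] mult_left_mono[OF T_A_norm_le[OF s G_in_D[OF t, of w]] less_imp_le[OF t]] s t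
    by (intro norm_triangle_mono) simp_all
  finally show ?thesis by (simp add: algebra_simps)
qed

end

text \<open>The discrete counterpart, with \<open>P = (1 + c (1 - F))\<^sup>-\<^sup>1\<close>.\<close>
lemma funpow_smoothing:
  assumes F: "pos_contraction F" and c: "0 \<le> c"
    and P: "\<And>w. P w + c *\<^sub>R (P w - F (P w)) = w"
  shows "norm ((F ^^ k) w) \<le> (1 + c / (real k + 1)) * norm (P w)"
proof -
  note lin = pos_contraction_linear[OF pos_contraction_funpow[OF F]]
  have "(F ^^ k) w = (F ^^ k) (P w) + c *\<^sub>R (F ^^ k) (P w - F (P w))"
    by (subst P[symmetric]) (simp only: linear_add[OF lin] linear_scale[OF lin])
  also have "norm \<dots> \<le> norm (P w) + c * (norm (P w) / (real k + 1))"
    using pos_contraction_norm[OF pos_contraction_funpow[OF F]] c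
      mult_left_mono[OF pos_contraction_funpow_diff_le[OF F, of k "P w"] c]
    by (intro norm_triangle_mono) simp_all
  finally show ?thesis by (simp add: algebra_simps)
qed

text \<open>Surjectivity is a fixed point argument: the equation to be solved is
  \<open>x = \<tau> / (\<tau> + 1) y + 1 / (\<tau> + 1) F x\<close>.\<close>
lemma bounded_nonneg_selfadjoint:
  assumes F: "pos_contraction F" and \<tau>: "0 < \<tau>"
  shows "nonneg_selfadjoint UNIV (\<lambda>x. (x - F x) /\<^sub>R \<tau>)"
proof
  have bc: "bounded_clinear F" using pos_contraction_bounded_clinear[OF F] .
  have scale_diff: "c *\<^sub>C (x - y) = c *\<^sub>C x - c *\<^sub>C y" for c and x y :: 'a
    using bounded_linear.linear[OF bounded_linear_scaleC] by (rule linear_diff)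
  have scale_R: "c *\<^sub>C (r *\<^sub>R x) = r *\<^sub>R (c *\<^sub>C x)" for c r and x :: 'a
    using bounded_linear.linear[OF bounded_linear_scaleC] by (rule linear_scale)
  show "linear_operator UNIV (\<lambda>x. (x - F x) /\<^sub>R \<tau>)"
    using bc by (simp add: linear_operator_def bounded_clinear_def scale_diff scale_R
        linear_add[OF pos_contraction_linear[OF F]] algebra_simps)
  show "rinner ((x - F x) /\<^sub>R \<tau>) y = rinner x ((y - F y) /\<^sub>R \<tau>)" for x y
    by (simp add: rinner_simps pos_contraction_symmetric[OF F])
  show "0 \<le> rinner x ((x - F x) /\<^sub>R \<tau>)" for x
    using rinner_funpow_diff_nonneg[OF F, of x 0 1] \<tau> by (simp add: rinner_scaleR_right)
  show "closure UNIV = (UNIV :: 'a set)" by simp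
  show "\<exists>x\<in>UNIV. x + (x - F x) /\<^sub>R \<tau> = y" for y
  proof -
    let ?f = "\<lambda>x. (\<tau> / (\<tau> + 1)) *\<^sub>R y + (1 / (\<tau> + 1)) *\<^sub>R F x"
    have "\<exists>!x. ?f x = x"
    proof (rule banach_fix_type[of "1 / (\<tau> + 1)"], use \<tau> in simp, use \<tau> in simp, intro allI)
      fix x z
      have "dist (?f x) (?f z) = 1 / (\<tau> + 1) * norm (F (x - z))"
        using \<tau> by (simp add: dist_norm linear_diff[OF pos_contraction_linear[OF F]] flip: scaleR_right_diff_distrib)
      also have "\<dots> \<le> 1 / (\<tau> + 1) * dist x z"
        unfolding dist_norm using pos_contraction_norm[OF F] \<tau> by (intro mult_left_mono) auto
      finally show "dist (?f x) (?f z) \<le> 1 / (\<tau> + 1) * dist x z" .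
    qed
    then obtain x where x: "?f x = x" by blast
    have "(\<tau> + 1) *\<^sub>R x = \<tau> *\<^sub>R y + F x"
      using \<tau> by (subst x[symmetric]) (simp add: scaleR_add_right)
    then have "\<tau> *\<^sub>R (x + (x - F x) /\<^sub>R \<tau>) = \<tau> *\<^sub>R y"
      using \<tau> by (simp add: algebra_simps)
    then show ?thesis using \<tau> by (intro bexI[of _ x]) simp_all
  qed
qed

context nonneg_selfadjoint
begin

text \<open>The constant arises as follows. With \<open>k = N div 6\<close> and \<open>a = 3 k\<close>, the power \<open>F\<^sup>a\<close> consists of three blocks \<open>F\<^sup>k\<close>, each absorbing one factor
  \<open>P\<^sup>-\<^sup>1\<close> with constant \<open>7\<close>; likewise \<open>\<Theta>\<^sup>b\<close> with \<open>b = N - a\<close> consists of three blocks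
  of duration at least \<open>t / 6\<close>. Both summands thus contribute \<open>7\<^sup>3 = 343\<close> times the weighted
  bound.\<close>
lemma power_semigroup_distance:
  assumes F: "pos_contraction F" and \<tau>: "0 < \<tau>" and N: "1 \<le> N" and t: "t = real N * \<tau>"
    and res: "\<And>x. norm (resolvent_inv UNIV (\<lambda>x. (x - F x) /\<^sub>R \<tau>) t x - resolvent_inv D A t x) \<le> \<delta> * norm x"
    and \<delta>: "0 \<le> \<delta>"
  shows "norm ((F ^^ N) y - T t y) \<le> 686 * (9 * \<delta> + 3 / 2 / real N) * norm y"
proof -
  interpret S: nonneg_selfadjoint UNIV "\<lambda>x. (x - F x) /\<^sub>R \<tau>"
    by (rule bounded_nonneg_selfadjoint[OF F \<tau>])
  have t0: "0 < t" "0 \<le> t" using N \<tau> t by simp_all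
  define P Q \<Theta> where "P = S.G t" and "Q = G t" and "\<Theta> = T \<tau>"
  have P: "pos_contraction P" and Q: "pos_contraction Q" and \<Theta>: "pos_contraction \<Theta>"
    using t0 \<tau> by (simp_all add: P_def Q_def \<Theta>_def S.G_pos_contraction G_pos_contraction T_pos_contraction)
  note linF = pos_contraction_linear[OF F] and linP = pos_contraction_linear[OF P]
    and linQ = pos_contraction_linear[OF Q] and lin\<Theta> = pos_contraction_linear[OF \<Theta>]
  note normF = pos_contraction_norm[OF F] and normP = pos_contraction_norm[OF P]
    and normQ = pos_contraction_norm[OF Q] and norm\<Theta> = pos_contraction_norm[OF \<Theta>]
  have PQ: "norm (P x - Q x) \<le> \<delta> * norm x" for x
    using res[of x] t0 by (simp add: P_def Q_def G_def S.G_def)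
  have tN: "t / \<tau> = real N" using t \<tau> by simp
  have P_eq: "P w + real N *\<^sub>R (P w - F (P w)) = w" for w
    using S.G_eq[OF t0(1), of w] tN by (simp add: P_def divide_inverse)
  have PF: "P (F x) = F (P x)" for x
  proof -
    have "P ((x - F x) /\<^sub>R \<tau>) = (P x - F (P x)) /\<^sub>R \<tau>"
      using S.A_G[OF t0(2), of x] by (simp add: P_def)
    then show ?thesis using \<tau> by (simp add: linear_diff[OF linP] linear_scale[OF linP])
  qed
  have Q\<Theta>: "Q (\<Theta> x) = \<Theta> (Q x)" for x
    using T_G[of \<tau> t x] \<tau> t0 by (simp add: Q_def \<Theta>_def)
  define e where "e = (\<delta> + 3 / 2 / real N) / real N"
  have Ne: "real N * e = \<delta> + 3 / 2 / real N" using N by (simp add: e_def)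
  have e0: "0 \<le> e" using \<delta> by (simp add: e_def)
  have step: "norm (P (F (Q (Q x)) - \<Theta> (Q (Q x)))) \<le> e * norm x" for x
  proof -
    define w v where "w = Q x" and "v = Q w"
    have w_eq: "w + t *\<^sub>R A w = x" and v_eq: "v + t *\<^sub>R A v = w"
      and wD: "w \<in> D" and vD: "v \<in> D"
      using t0 by (simp_all add: w_def v_def Q_def G_eq G_in_D)
    have tAv: "A v = (1 / t) *\<^sub>R (w - v)" using v_eq t0 by (simp add: algebra_simps flip: v_eq)
    have AvD: "A v \<in> D" unfolding tAv by (intro D_scaleR D_diff wD vD)
    have vD2: "v \<in> D2" using vD AvD by (simp add: D2_def)
    have "t *\<^sub>R A (t *\<^sub>R A v) = (x - w) - (w - v)"
    proof -
      have "t *\<^sub>R A v = w - v" "t *\<^sub>R A w = x - w" using v_eq w_eq by (simp_all add: algebra_simps)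
      then show ?thesis using v_eq by (simp add: A_diff wD vD scaleR_diff_right)
    qed
    also have "\<dots> = (x - w) - Q (x - w)" by (simp add: linear_diff[OF linQ] v_def w_def)
    finally have AAv: "t\<^sup>2 *\<^sub>R A (A v) = (x - w) - Q (x - w)"
      by (simp add: A_scaleR[OF AvD] power2_eq_square)
    have "t\<^sup>2 * norm (A (A v)) = norm (t\<^sup>2 *\<^sub>R A (A v))" by simp
    also have "\<dots> \<le> norm (x - w)"
      unfolding AAv using norm_diff_G[OF t0(2), of "x - w"] by (simp add: Q_def)
    also have "\<dots> \<le> norm x"
      using norm_diff_G[OF t0(2), of x] by (simp add: Q_def w_def)
    finally have AAv_norm: "t\<^sup>2 * norm (A (A v)) \<le> norm x" .
    \<comment> \<open>The second-order part of \<open>\<Theta>\<close>; the weight \<open>Q\<^sup>2\<close> makes \<open>t\<^sup>2 A\<^sup>2 v\<close> bounded by \<open>x\<close>.\<close>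
    have "norm (\<Theta> v - v + \<tau> *\<^sub>R A v) \<le> 3 / 2 * \<tau>\<^sup>2 * norm (A (A v))"
      unfolding \<Theta>_def using \<tau> vD2 by (intro T_taylor) auto
    also have "\<dots> = 3 / 2 / (real N)\<^sup>2 * (t\<^sup>2 * norm (A (A v)))"
      using N by (simp add: t power_mult_distrib)
    also have "\<dots> \<le> 3 / 2 / (real N)\<^sup>2 * norm x"
      using AAv_norm by (intro mult_left_mono) auto
    finally have taylor: "norm (\<Theta> v - v + \<tau> *\<^sub>R A v) \<le> 3 / 2 / (real N)\<^sup>2 * norm x" .
    \<comment> \<open>The first-order parts: \<open>P (t A - N (1 - F)) Q = P - Q\<close>, applied to \<open>w\<close>.\<close>
    have "real N *\<^sub>R (F v - v + \<tau> *\<^sub>R A v) = w - (v + real N *\<^sub>R (v - F v))"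
      using v_eq by (simp add: t algebra_simps flip: v_eq)
    moreover have "P (v + real N *\<^sub>R (v - F v)) = v"
      using P_eq[of v] by (simp add: linear_add[OF linP] linear_diff[OF linP] linear_scale[OF linP] PF)
    ultimately have "real N *\<^sub>R P (F v - v + \<tau> *\<^sub>R A v) = P w - Q w"
      by (metis linear_scale[OF linP] linear_diff[OF linP] v_def)
    then have "real N * norm (P (F v - v + \<tau> *\<^sub>R A v)) = norm (P w - Q w)"
      by (metis norm_scaleR abs_of_nat)
    also have "\<dots> \<le> \<delta> * norm x"
      using order_trans[OF PQ[of w] mult_left_mono[OF normQ[of x, folded w_def] \<delta>]] .
    finally have first: "norm (P (F v - v + \<tau> *\<^sub>R A v)) \<le> \<delta> / real N * norm x"
      using N by (simp add: field_simps)
    \<comment> \<open>Insert the common first-order expansion \<open>v - \<tau> A v\<close>.\<close>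
    have "P (F v - \<Theta> v) = P (F v - v + \<tau> *\<^sub>R A v) - P (\<Theta> v - v + \<tau> *\<^sub>R A v)"
      by (simp flip: linear_diff[OF linP])
    also have "norm \<dots> \<le> \<delta> / real N * norm x + 3 / 2 / (real N)\<^sup>2 * norm x"
      by (rule order_trans[OF norm_triangle_ineq4 add_mono[OF first order_trans[OF normP taylor]]])
    also have "\<dots> = e * norm x" by (simp add: e_def add_divide_distrib power2_eq_square distrib_right)
    finally show ?thesis by (simp only: v_def w_def)
  qed
  \<comment> \<open>The part of \<open>\<Theta>\<close> may be cut at real times, so only the part of \<open>F\<close> must be a multiple of three.\<close>
  define k a b where "k = N div 6" and "a = 3 * k" and "b = N - a"
  have k: "6 * k \<le> N" "N \<le> 6 * (k + 1)" unfolding k_def by presburger+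
  then have aN: "a \<le> N" "N = a + b" and b_pos: "0 < b" and Nb: "N \<le> 2 * b"
    using N unfolding a_def b_def by linarith+
  have Nk: "real N \<le> 6 * (real k + 1)"
  proof -
    have "real N \<le> real (6 * (k + 1))" unfolding of_nat_le_iff by (rule k(2))
    then show ?thesis by simp
  qed
  note cmp = weighted_power_comparison[OF linF lin\<Theta> linP linQ normF norm\<Theta> normP normQ PF Q\<Theta> PQ step \<delta> e0]
  have n_e: "real n * e \<le> \<delta> + 3 / 2 / real N" if "n \<le> N" for n
    using mult_right_mono[of "real n" "real N", OF _ e0] that by (simp add: Ne)
  let ?E = "(\<delta> + 3 / 2 / real N + 8 * \<delta>) * norm y"
  define Z where "Z n x = (F ^^ n) x - (\<Theta> ^^ n) x" for n x
  have Z_sym: "rinner (Z n x) z = rinner x (Z n z)" for n x z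
    by (simp add: Z_def rinner_simps rinner_funpow_symmetric pos_contraction_symmetric[OF F]
        pos_contraction_symmetric[OF \<Theta>])
  have first: "norm ((F ^^ a) (Z b y)) \<le> 343 * ?E"
  proof -
    have smooth: "norm ((F ^^ k) w) \<le> 7 * norm (P w)" for w
    proof -
      have "norm ((F ^^ k) w) \<le> (1 + real N / (real k + 1)) * norm (P w)"
        by (rule funpow_smoothing[OF F _ P_eq]) simp
      also have "\<dots> \<le> 7 * norm (P w)"
        using Nk by (intro mult_right_mono) (auto simp: field_simps)
      finally show ?thesis .
    qed
    have "(F ^^ a) (Z b y) = (F ^^ k) ((F ^^ k) ((F ^^ k) (Z b y)))"
      by (simp add: a_def numeral_3_eq_3 funpow_add)
    also have "norm \<dots> \<le> 7 ^ 3 * norm (P (P (P (Z b y))))"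
      by (rule iterate_smoothing[OF smooth]) (simp_all add: funpow_commute[symmetric] PF)
    also have "norm (P (P (P (Z b y)))) \<le> (real b * e + 8 * \<delta>) * norm y"
    proof (rule adjoint_norm_le[where K = "\<lambda>x. Z b (P (P (P x)))"])
      show "norm (Z b (P (P (P x)))) \<le> (real b * e + 8 * \<delta>) * norm x" for x
        by (rule cmp(2)) (rule Z_def)
      show "rinner (Z b (P (P (P x)))) z = rinner x (P (P (P (Z b z))))" for x z
        by (simp add: Z_sym pos_contraction_symmetric[OF P])
    qed
    also have "(real b * e + 8 * \<delta>) * norm y \<le> ?E"
      using n_e[of b] aN by (intro mult_right_mono) auto
    finally show ?thesis by simp
  qed
  have second: "norm (Z a ((\<Theta> ^^ b) y)) \<le> 343 * ?E"
  proof -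
    define s where "s = real b * \<tau> / 3"
    have s: "0 < s" using b_pos \<tau> by (simp add: s_def)
    have smooth: "norm (T s w) \<le> 7 * norm (Q w)" for w
    proof -
      have "norm (T s w) \<le> (1 + t / s) * norm (Q w)" unfolding Q_def by (rule T_smoothing[OF s t0(1)])
      also have "\<dots> \<le> 7 * norm (Q w)"
      proof (intro mult_right_mono)
        have "real N \<le> 2 * real b" using Nb by linarith
        then have "t \<le> 6 * s" using \<tau> by (simp add: t s_def)
        then show "1 + t / s \<le> 7" using s by (simp add: field_simps)
      qed simp
      finally show ?thesis .
    qed
    have \<Theta>b: "(\<Theta> ^^ b) w = T s (T s (T s w))" for w
      using T_funpow[of \<tau> b w] T_funpow[of s 3 w] \<tau> s by (simp add: \<Theta>_def s_def numeral_3_eq_3)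
    have bound: "norm ((\<Theta> ^^ b) (Z a x)) \<le> (343 * (real a * e + 8 * \<delta>)) * norm x" for x
    proof -
      have "norm ((\<Theta> ^^ b) (Z a x)) \<le> 7 ^ 3 * norm (Q (Q (Q (Z a x))))"
        unfolding \<Theta>b using s t0 by (intro iterate_smoothing[OF smooth]) (simp_all add: Q_def T_G)
      also have "norm (Q (Q (Q (Z a x)))) \<le> (real a * e + 2 * \<delta>) * norm x"
      proof (rule adjoint_norm_le[where K = "\<lambda>x. Z a (Q (Q (Q x)))"])
        show "norm (Z a (Q (Q (Q x)))) \<le> (real a * e + 2 * \<delta>) * norm x" for x
          by (rule cmp(1)) (rule Z_def)
        show "rinner (Z a (Q (Q (Q x)))) z = rinner x (Q (Q (Q (Z a z))))" for x z
          by (simp add: Z_sym pos_contraction_symmetric[OF Q])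
      qed
      also have "\<dots> \<le> (real a * e + 8 * \<delta>) * norm x"
        using \<delta> by (intro mult_right_mono) auto
      finally have "norm ((\<Theta> ^^ b) (Z a x)) \<le> 343 * ((real a * e + 8 * \<delta>) * norm x)" by simp
      then show ?thesis by (simp only: mult.assoc)
    qed
    have "norm (Z a ((\<Theta> ^^ b) y)) \<le> (343 * (real a * e + 8 * \<delta>)) * norm y"
      by (rule adjoint_norm_le[OF bound])
         (simp add: Z_sym rinner_funpow_symmetric[of \<Theta>] pos_contraction_symmetric[OF \<Theta>])
    also have "\<dots> \<le> 343 * ?E"
      using n_e[of a] aN by (simp only: mult.assoc) (intro mult_left_mono mult_right_mono, auto)
    finally show ?thesis .
  qed
  have "(F ^^ N) y - T t y = (F ^^ a) (Z b y) + Z a ((\<Theta> ^^ b) y)"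
  proof -
    have "T t y = (\<Theta> ^^ a) ((\<Theta> ^^ b) y)"
      using T_funpow[of \<tau> N y] \<tau> by (simp add: \<Theta>_def t aN(2) funpow_add)
    moreover have "(F ^^ N) y = (F ^^ a) ((F ^^ b) y)" by (simp add: aN(2) funpow_add)
    ultimately show ?thesis by (simp add: Z_def linear_diff[OF linear_funpow[OF linF]])
  qed
  then have "norm ((F ^^ N) y - T t y) \<le> 343 * ?E + 343 * ?E"
    using norm_triangle_mono[OF first second] by simp
  also have "\<dots> \<le> 686 * (9 * \<delta> + 3 / 2 / real N) * norm y"
    by (simp add: algebra_simps)
  finally show ?thesis .
qed

end

section \<open>Self-adjointness and the strong resolvent limit\<close>

text \<open>The value of the adjoint is well defined because \<open>D\<close> is dense.\<close>
lemma selfadjoint_operator_symmetric: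
  assumes A: "selfadjoint_operator D A" and x: "x \<in> D" and y: "y \<in> D"
  shows "cinner (A x) y = cinner x (A y)"
proof -
  have "y \<in> adjoint_domain D A" using A y by (simp add: selfadjoint_operator_def)
  then obtain z where z: "\<forall>x\<in>D. cinner (A x) y = cinner x z"
    unfolding adjoint_domain_def by blast
  have "z' = z" if z': "\<forall>x\<in>D. cinner (A x) y = cinner x z'" for z'
  proof -
    have "rinner (z' - z) (z' - z) = 0"
    proof (rule continuous_eq_on_dense[where S = D and f = "\<lambda>x. rinner x (z' - z)" and g = "\<lambda>_. 0"])
      show "closure D = UNIV" using A by (simp add: selfadjoint_operator_def)
      show "continuous_on UNIV (\<lambda>x. rinner x (z' - z))"
        by (intro linear_continuous_on bounded_bilinear.bounded_linear_left[OF bounded_bilinear_rinner])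
      show "rinner x (z' - z) = 0" if "x \<in> D" for x
        using z z' that by (simp add: rinner_diff_right) (simp add: rinner_def)
    qed simp
    then show ?thesis by (simp add: rinner_self)
  qed
  with z have "adjoint_operator D A y = z" unfolding adjoint_operator_def by (intro the_equality)
  then have "A y = z" using A y by (simp add: selfadjoint_operator_def)
  then show ?thesis using z x by simp
qed

text \<open>A vector on which the adjoint is defined, even only in the sense of real inner products, belongs
  to the domain: testing with \<open>\<i> x\<close> recovers the imaginary parts.\<close>
lemma selfadjoint_operator_maximal:
  assumes A: "selfadjoint_operator D A"
    and adj: "\<And>x. x \<in> D \<Longrightarrow> rinner (A x) y = rinner x z"
  shows "y \<in> D \<and> A y = z"
proof -
  have lin: "linear_operator D A" and dense: "closure D = UNIV" using A by (simp_all add: selfadjoint_operator_def)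
  have "cinner (A x) y = cinner x z" if x: "x \<in> D" for x
  proof (rule complex_eqI)
    show "Re (cinner (A x) y) = Re (cinner x z)" using adj[OF x] by (simp add: rinner_def)
    show "Im (cinner (A x) y) = Im (cinner x z)"
      using adj[of "\<i> *\<^sub>C x"] lin x by (simp add: Im_cinner_eq_rinner linear_operator_def)
  qed
  then have "y \<in> adjoint_domain D A" unfolding adjoint_domain_def by blast
  then have y: "y \<in> D" using A by (simp add: selfadjoint_operator_def)
  have "rinner (A y - z) (A y - z) = 0"
  proof (rule continuous_eq_on_dense[OF dense, where f = "\<lambda>x. rinner x (A y - z)" and g = "\<lambda>_. 0"])
    show "continuous_on UNIV (\<lambda>x. rinner x (A y - z))"
      by (intro linear_continuous_on bounded_bilinear.bounded_linear_left[OF bounded_bilinear_rinner])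
    show "rinner x (A y - z) = 0" if "x \<in> D" for x
      using adj[OF that] selfadjoint_operator_symmetric[OF A that y]
      by (simp add: rinner_diff_right) (simp add: rinner_def)
  qed simp
  then show ?thesis using y by (simp add: rinner_self)
qed

lemma nonneg_symmetricI:
  assumes A: "selfadjoint_operator D A" and nonneg: "nonneg_operator D A"
  shows "nonneg_symmetric D A"
proof
  show "linear_operator D A" "closure D = UNIV" using A by (simp_all add: selfadjoint_operator_def)
  show "rinner (A x) y = rinner x (A y)" if "x \<in> D" "y \<in> D" for x y
    using selfadjoint_operator_symmetric[OF A that] by (simp add: rinner_def)
  show "0 \<le> rinner x (A x)" if "x \<in> D" for x
    using nonneg that by (auto simp: nonneg_operator_def rinner_def complex_nonneg_Reals_iff)
qed

lemma pos_contractionI: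
  assumes "bounded_clinear K" "selfadjoint_operator UNIV K" "nonneg_operator UNIV K" "onorm K \<le> 1"
  shows "pos_contraction K"
proof -
  interpret nonneg_symmetric UNIV K using assms by (intro nonneg_symmetricI)
  have "norm (K x) \<le> norm x" for x
    using onorm[of K x] mult_right_mono[OF assms(4), of "norm x"] assms(1)
    by (simp add: bounded_clinear_def)
  then show ?thesis using symmetric nonneg assms(1) by (simp add: pos_contraction_def)
qed

lemma (in nonneg_selfadjoint) resolvent_inv_pos_contraction:
  "0 < s \<Longrightarrow> pos_contraction (resolvent_inv D A s)"
  using G_pos_contraction[of s] by (simp add: G_def)

text \<open>For \<open>x\<close> in \<open>D\<close> and \<open>w = (1 + A) x\<close> the value of the resolvent at \<open>w\<close> is \<open>x\<close> by injectivity
  alone, even while the map might be arbitrary off the range of \<open>1 + A\<close>. Passing to the limit in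
  \<open>\<langle>w, P \<tau> y\<rangle> = \<langle>P \<tau> w, y\<rangle>\<close> then identifies the limit of \<open>P \<tau> y\<close>
  as a preimage of \<open>y\<close>.\<close>
lemma nonneg_selfadjoint_if_resolvent_limit:
  assumes A: "selfadjoint_operator D A" and nonneg: "nonneg_operator D A"
    and P: "\<And>\<tau>. 0 < \<tau> \<Longrightarrow> pos_contraction (P \<tau>)"
    and lim: "\<And>x. ((\<lambda>\<tau>. P \<tau> x) \<longlongrightarrow> resolvent_inv D A 1 x) (at_right (0::real))"
  shows "nonneg_selfadjoint D A"
proof -
  interpret nonneg_symmetric D A by (rule nonneg_symmetricI[OF A nonneg])
  show ?thesis
  proof
    fix y
    define u where "u = resolvent_inv D A 1 y"
    have "rinner (A x) u = rinner x (y - u)" if x: "x \<in> D" for x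
    proof -
      define w where "w = x + A x"
      have Rw: "resolvent_inv D A 1 w = x" using resolvent_inv_shift[of 1 x] x by (simp add: w_def)
      have 1: "((\<lambda>\<tau>. rinner w (P \<tau> y)) \<longlongrightarrow> rinner w u) (at_right 0)"
        unfolding u_def by (intro bounded_bilinear.tendsto[OF bounded_bilinear_rinner] tendsto_const lim)
      have 2: "((\<lambda>\<tau>. rinner (P \<tau> w) y) \<longlongrightarrow> rinner x y) (at_right 0)"
        using bounded_bilinear.tendsto[OF bounded_bilinear_rinner lim[of w] tendsto_const[of y]]
        unfolding Rw .
      have "\<forall>\<^sub>F \<tau> in at_right 0. rinner (P \<tau> w) y = rinner w (P \<tau> y)"
        using eventually_at_right_less[of 0]
        by eventually_elim (simp add: pos_contraction_symmetric[OF P])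
      from Lim_transform_eventually[OF 2 this] have "rinner w u = rinner x y"
        by (rule tendsto_unique[OF trivial_limit_at_right_real 1])
      then show ?thesis by (simp add: w_def rinner_simps)
    qed
    then have "u \<in> D \<and> A u = y - u" by (rule selfadjoint_operator_maximal[OF A])
    then show "\<exists>x\<in>D. x + A x = y" by (intro bexI[of _ u]) simp_all
  qed
qed

section \<open>The convergence rate\<close>

text \<open>For \<open>t > 0\<close> the resolvent hypothesis is used only at \<open>\<tau> = t / n\<close>, where
  \<open>\<tau> / t = 1 / n\<close> is independent of \<open>t\<close>; this makes the bound uniform in \<open>t\<close>. The term of order
  \<open>1 / n\<close> is absorbed because \<open>\<rho> \<le> 1\<close>.\<close>
theorem theorem3p4:
  fixes F S :: "real \<Rightarrow> 'a::complex_hilbert_space \<Rightarrow> 'a"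
    and D :: "'a set" and H :: "'a \<Rightarrow> 'a" and \<rho> M :: real
  assumes F_measurable:
      "\<forall>x y. (\<lambda>t. cinner x (F t y)) \<in> borel_measurable (lebesgue_on {0..})"
    and F_bounded: "\<forall>t\<ge>0. bounded_clinear (F t)"
    and F_selfadjoint: "\<forall>t\<ge>0. selfadjoint_operator UNIV (F t)"
    and F_nonneg: "\<forall>t\<ge>0. nonneg_operator UNIV (F t)"
    and F_contraction: "\<forall>t\<ge>0. onorm (F t) \<le> 1"
    and F_0: "F 0 = id"
    and S: "\<forall>\<tau>>0. S \<tau> = (\<lambda>x. (x - F \<tau> x) /\<^sub>R \<tau>)"
    and H_selfadjoint: "selfadjoint_operator D H"
    and H_nonneg: "nonneg_operator D H"
    and strong_limit:
      "\<forall>x. ((\<lambda>\<tau>. resolvent_inv UNIV (S \<tau>) 1 x) \<longlongrightarrow> resolvent_inv D H 1 x) (at_right 0)"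
    and \<rho>: "0 < \<rho>" "\<rho> \<le> 1"
    and M: "M > 0"
    and resolvent_bound:
      "\<forall>\<tau> t. 0 < \<tau> \<and> \<tau> \<le> t \<longrightarrow>
         onorm (\<lambda>x. resolvent_inv UNIV (S \<tau>) t x - resolvent_inv D H t x) \<le> M * (\<tau> / t) powr \<rho>"
  shows "\<exists>c>0. \<forall>n::nat. n \<ge> 1 \<longrightarrow>
           (SUP t\<in>{0..}. ereal (onorm (\<lambda>x. (F (t / real n) ^^ n) x
               - semigroup_exp D (\<lambda>x. - H x) t x)))
           \<le> ereal (c * (1 / real n powr \<rho>))"
proof -
  have F: "pos_contraction (F t)" if "0 \<le> t" for t
    using that F_bounded F_selfadjoint F_nonneg F_contraction by (intro pos_contractionI) simp_all
  have S_res: "pos_contraction (resolvent_inv UNIV (S \<tau>) t)" if "0 < \<tau>" "0 < t" for \<tau> t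
    using nonneg_selfadjoint.resolvent_inv_pos_contraction[OF bounded_nonneg_selfadjoint[OF F]] that S
    by simp
  interpret H: nonneg_selfadjoint D H
    by (rule nonneg_selfadjoint_if_resolvent_limit[OF H_selfadjoint H_nonneg,
          where P = "\<lambda>\<tau>. resolvent_inv UNIV (S \<tau>) 1"])
       (use S_res strong_limit in simp_all)
  define c where "c = 686 * (9 * M + 3 / 2)"
  have c: "0 < c" using M by (simp add: c_def)
  have pointwise: "norm ((F (t / real n) ^^ n) x - H.T t x) \<le> c * (1 / real n powr \<rho>) * norm x"
    if n: "1 \<le> n" and t: "0 \<le> t" for n :: nat and t x
  proof (cases "t = 0")
    case True
    then show ?thesis using c by (simp add: F_0 id_funpow)
  next
    case False
    define \<tau> where "\<tau> = t / real n"
    have \<tau>: "0 < \<tau>" "\<tau> \<le> t" "t = real n * \<tau>" and t: "0 < t"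
      using False t n by (simp_all add: \<tau>_def divide_le_eq)
    define r where "r = 1 / real n powr \<rho>"
    have "(\<tau> / t) powr \<rho> = r"
      using n t by (simp add: \<tau>_def r_def powr_divide)
    then have onorm_le: "onorm (\<lambda>x. resolvent_inv UNIV (S \<tau>) t x - resolvent_inv D H t x) \<le> M * r"
      using resolvent_bound \<tau> by metis
    have bl: "bounded_linear (\<lambda>x. resolvent_inv UNIV (S \<tau>) t x - resolvent_inv D H t x)"
      by (intro bounded_linear_sub pos_contraction_bounded_linear S_res
          H.resolvent_inv_pos_contraction \<tau>(1) t)
    have S_eq: "S \<tau> = (\<lambda>x. (x - F \<tau> x) /\<^sub>R \<tau>)" using S \<tau> by simp
    have "norm (resolvent_inv UNIV (S \<tau>) t x - resolvent_inv D H t x) \<le> M * r * norm x" for x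
      using order_trans[OF onorm[OF bl] mult_right_mono[OF onorm_le norm_ge_zero]] .
    then have "norm ((F \<tau> ^^ n) x - H.T t x) \<le> 686 * (9 * (M * r) + 3 / 2 / real n) * norm x"
      unfolding S_eq using \<tau> n M
      by (intro H.power_semigroup_distance F) (simp_all add: r_def)
    also have "\<dots> \<le> c * r * norm x"
    proof -
      have "real n powr \<rho> \<le> real n powr 1" using n \<rho> by (intro powr_mono) auto
      then have "1 / real n \<le> r" using n by (simp add: r_def frac_le)
      then have "686 * (9 * (M * r) + 3 / 2 / real n) \<le> c * r" by (simp add: c_def algebra_simps)
      then show ?thesis by (rule mult_right_mono) simp
    qed
    finally show ?thesis by (simp add: \<tau>_def r_def)
  qed
  show ?thesis
  proof (intro exI[of _ c] conjI c allI impI SUP_least)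
    fix n :: nat and t :: real assume n: "1 \<le> n" and "t \<in> {0..}"
    then have t: "0 \<le> t" by simp
    have "onorm (\<lambda>x. (F (t / real n) ^^ n) x - H.T t x) \<le> c * (1 / real n powr \<rho>)"
      using c by (intro onorm_bound pointwise[OF n t]) auto
    then show "ereal (onorm (\<lambda>x. (F (t / real n) ^^ n) x - semigroup_exp D (\<lambda>x. - H x) t x))
        \<le> ereal (c * (1 / real n powr \<rho>))"
      by (simp add: H.semigroup_exp_eq_T[OF t])
  qed
qed

end
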